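(* Let $\mathbf{k}$ be an algebraically closed field, let $V_1,V_2$ be finite dimensional $\mathbf{k}$-vector spaces with $\dim(V_i)\geq2$, let $V=V_1\oplus V_2$, and let $K\subseteq V_1\otimes V_2$ be a subspace. Let $\mathcal{W}(V,K)$ be the associated Koszul sheaf on $\mathbf{P}=\mathbb{P}V_1\times\mathbb{P}V_2$, and let $K^\perp=\{\phi\in V_1^\vee\otimes V_2^\vee:\phi|_K=0\}$. Then $\mathcal{W}(V,K)=0$ if and only if $K^\perp$ contains no non-zero tensors of rank at most two.
   Context: $\mathbb{P}V_i$ is the projective space with $\mathrm{H}^0(\mathbb{P}V_i,\mathcal{O}(1))=V_i$ (its points are classes $[f_i]$ of non-zero $f_i\in V_i^\vee$). The Koszul sheaf $\mathcal{W}(V,K)$ is the middle homology of the complex $$K\otimes\mathcal{O}_{\mathbf{P}}\xrightarrow{\alpha}V_1\otimes\mathcal{O}_{\mathbf{P}}(0,1)\oplus V_2\otimes\mathcal{O}_{\mathbf{P}}(1,0)\xrightarrow{\beta}\mathcal{O}_{\mathbf{P}}(1,1)$$ obtained by sheafifying the Koszul differentials $K\otimes S\to V\otimes S\to S$, $S=\operatorname{Sym}(V)$ bi-graded with $S_{1,0}=V_1$, $S_{0,1}=V_2$: $\alpha(v_1\otimes v_2)=v_1\otimes v_2-v_2\otimes v_1$ (first term in $V_1\otimes\mathcal{O}(0,1)$, second in $V_2\otimes\mathcal{O}(1,0)$, extended linearly to $K\subseteq V_1\otimes V_2$), and $\beta(v\otimes s)=vs$. *)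

theory Defs
  imports
    "HOL-Analysis.Abstract_Topology"
    "HOL-Algebra.Coset"
    "HOL-Library.Function_Algebras"
    "HOL-Computational_Algebra.Polynomial"
begin

section \<open>Presheaves of abelian groups, sheafification, homology sheaves\<close>

record ('x, 's) presheaf =
  base :: "'x topology"
  sections :: "'x set \<Rightarrow> 's monoid"
  restr :: "'x set \<Rightarrow> 'x set \<Rightarrow> 's \<Rightarrow> 's"

text \<open>The germ at \<open>x\<close> of a section \<open>s\<close> over \<open>U\<close>, as an equivalence class of pairs (open
  neighbourhood of \<open>x\<close>, section over it).\<close>

definition germ :: "('x, 's) presheaf \<Rightarrow> 'x \<Rightarrow> 'x set \<Rightarrow> 's \<Rightarrow> ('x set \<times> 's) set" where
  "germ F x U s = {(V, t). openin (base F) V \<and> x \<in> V \<and> t \<in> carrier (sections F V) \<and>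
     (\<exists>W. openin (base F) W \<and> x \<in> W \<and> W \<subseteq> U \<inter> V \<and> restr F U W s = restr F V W t)}"

text \<open>Addition in the stalk at \<open>x\<close>. All germs in the union coincide, so the union is the germ of
  the sum of any two representatives.\<close>

definition germ_add :: "('x, 's) presheaf \<Rightarrow> 'x \<Rightarrow> ('x set \<times> 's) set \<Rightarrow> ('x set \<times> 's) set
    \<Rightarrow> ('x set \<times> 's) set" where
  "germ_add F x a b = (\<Union>(U, s)\<in>a. \<Union>(V, t)\<in>b.
     germ F x (U \<inter> V)
       (restr F U (U \<inter> V) s \<otimes>\<^bsub>sections F (U \<inter> V)\<^esub> restr F V (U \<inter> V) t))"

definition sheafify :: "('x, 's) presheaf \<Rightarrow> ('x, 'x \<Rightarrow> ('x set \<times> 's) set) presheaf" where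
  "sheafify F =
    \<lparr>base = base F,
     sections = (\<lambda>U.
       \<lparr>carrier = {\<tau> \<in> extensional U. \<forall>x\<in>U. \<exists>V s. openin (base F) V \<and> x \<in> V \<and> V \<subseteq> U \<and>
                     s \<in> carrier (sections F V) \<and> (\<forall>y\<in>V. \<tau> y = germ F y V s)},
        monoid.mult = (\<lambda>\<sigma> \<tau>. \<lambda>x\<in>U. germ_add F x (\<sigma> x) (\<tau> x)),
        one = (\<lambda>x\<in>U. germ F x U \<one>\<^bsub>sections F U\<^esub>)\<rparr>),
     restr = (\<lambda>U V \<tau>. restrict \<tau> V)\<rparr>"

definition zero_sheaf :: "('x, 's) presheaf \<Rightarrow> bool" where
  "zero_sheaf F \<longleftrightarrow> (\<forall>U. openin (base F) U \<longrightarrow> carrier (sections F U) = {\<one>\<^bsub>sections F U\<^esub>})"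

text \<open>The presheaf \<open>U \<mapsto> ker \<beta>(U) / im \<alpha>(U)\<close> of a complex \<open>A \<rightarrow> B \<rightarrow> C\<close>; a coset restricts to
  the coset of the restriction of any of its elements.\<close>

definition homology_presheaf ::
  "('x, 'a) presheaf \<Rightarrow> ('x set \<Rightarrow> 'a \<Rightarrow> 'b) \<Rightarrow> ('x, 'b) presheaf \<Rightarrow> ('x set \<Rightarrow> 'b \<Rightarrow> 'c)
    \<Rightarrow> ('x, 'c) presheaf \<Rightarrow> ('x, 'b set) presheaf" where
  "homology_presheaf A \<alpha> B \<beta> C =
    \<lparr>base = base B,
     sections = (\<lambda>U. (sections B U)\<lparr>carrier := kernel (sections B U) (sections C U) (\<beta> U)\<rparr>
                       Mod (\<alpha> U ` carrier (sections A U))),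
     restr = (\<lambda>U V c. (\<alpha> V ` carrier (sections A V)) <#>\<^bsub>sections B V\<^esub> (restr B U V ` c))\<rparr>"

definition homology_sheaf ::
  "('x, 'a) presheaf \<Rightarrow> ('x set \<Rightarrow> 'a \<Rightarrow> 'b) \<Rightarrow> ('x, 'b) presheaf \<Rightarrow> ('x set \<Rightarrow> 'b \<Rightarrow> 'c)
    \<Rightarrow> ('x, 'c) presheaf \<Rightarrow> ('x, 'x \<Rightarrow> ('x set \<times> 'b set) set) presheaf" where
  "homology_sheaf A \<alpha> B \<beta> C = sheafify (homology_presheaf A \<alpha> B \<beta> C)"

definition direct_sum_sheaf ::
  "('x, 'a) presheaf \<Rightarrow> ('x, 'b) presheaf \<Rightarrow> ('x, 'a \<times> 'b) presheaf" where
  "direct_sum_sheaf A B =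
    \<lparr>base = base A,
     sections = (\<lambda>U. sections A U \<times>\<times> sections B U),
     restr = (\<lambda>U V. map_prod (restr A U V) (restr B U V))\<rparr>"


section \<open>Duals and tensor products\<close>

text \<open>Vector spaces are given, as in \<open>Vector_Spaces\<close>, by a type of vectors and a scalar
  multiplication \<open>s\<close>.\<close>

definition dual :: "('k::field \<Rightarrow> 'v::ab_group_add \<Rightarrow> 'v) \<Rightarrow> ('v \<Rightarrow> 'k) set" where
  "dual s = {f. Vector_Spaces.linear s (*) f}"

text \<open>\<open>V\<^sub>1 \<otimes> V\<^sub>2\<close> is realised as the span of the functions \<open>(f, g) \<mapsto> f(v) g(w)\<close> on
  \<open>V\<^sub>1\<^sup>\<or> \<times> V\<^sub>2\<^sup>\<or>\<close>, extended by \<open>0\<close> to functions \<open>f\<close>, \<open>g\<close> that are not linear.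
  The lemma \<open>tensor_lift_sum\<close> below is its universal property.\<close>

type_synonym ('k, 'v, 'w) tensor = "('v \<Rightarrow> 'k) \<Rightarrow> ('w \<Rightarrow> 'k) \<Rightarrow> 'k"

definition pure_tensor :: "('k::field \<Rightarrow> 'v::ab_group_add \<Rightarrow> 'v) \<Rightarrow> ('k \<Rightarrow> 'w::ab_group_add \<Rightarrow> 'w)
    \<Rightarrow> 'v \<Rightarrow> 'w \<Rightarrow> ('k, 'v, 'w) tensor" where
  "pure_tensor s1 s2 v w = (\<lambda>f g. if f \<in> dual s1 \<and> g \<in> dual s2 then f v * g w else 0)"

definition tensor_sum :: "('k::field \<Rightarrow> 'v::ab_group_add \<Rightarrow> 'v) \<Rightarrow> ('k \<Rightarrow> 'w::ab_group_add \<Rightarrow> 'w)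
    \<Rightarrow> ('v \<times> 'w) list \<Rightarrow> ('k, 'v, 'w) tensor" where
  "tensor_sum s1 s2 xs = (\<Sum>(v, w)\<leftarrow>xs. pure_tensor s1 s2 v w)"

definition tensor_space :: "('k::field \<Rightarrow> 'v::ab_group_add \<Rightarrow> 'v) \<Rightarrow> ('k \<Rightarrow> 'w::ab_group_add \<Rightarrow> 'w)
    \<Rightarrow> ('k, 'v, 'w) tensor set" where
  "tensor_space s1 s2 = range (tensor_sum s1 s2)"

definition tensor_scale :: "'k::field \<Rightarrow> ('k, 'v, 'w) tensor \<Rightarrow> ('k, 'v, 'w) tensor" where
  "tensor_scale c t = (\<lambda>f g. c * t f g)"

text \<open>The value at \<open>t\<close> of the linear extension of \<open>v \<otimes> w \<mapsto> b v w\<close>, for \<open>b\<close> bilinear.\<close>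

definition tensor_lift :: "('k::field \<Rightarrow> 'v::ab_group_add \<Rightarrow> 'v) \<Rightarrow> ('k \<Rightarrow> 'w::ab_group_add \<Rightarrow> 'w)
    \<Rightarrow> ('v \<Rightarrow> 'w \<Rightarrow> 'u::ab_group_add) \<Rightarrow> ('k, 'v, 'w) tensor \<Rightarrow> 'u" where
  "tensor_lift s1 s2 b t = (THE u. \<forall>xs. t = tensor_sum s1 s2 xs \<longrightarrow> u = (\<Sum>(v, w)\<leftarrow>xs. b v w))"

lemma tensor_sum_apply:
  assumes "f \<in> dual s1" "g \<in> dual s2"
  shows "tensor_sum s1 s2 xs f g = (\<Sum>(v, w)\<leftarrow>xs. f v * g w)"
  using assms by (induction xs) (auto simp: tensor_sum_def pure_tensor_def)

lemma tensor_lift_sum: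
  assumes fd1: "finite_dimensional_vector_space s1 B1"
    and fd2: "finite_dimensional_vector_space s2 B2"
    and lin1: "\<And>w. Vector_Spaces.linear s1 s (\<lambda>v. b v w)"
    and lin2: "\<And>v. Vector_Spaces.linear s2 s (b v)"
  shows "tensor_lift s1 s2 b (tensor_sum s1 s2 xs) = (\<Sum>(v, w)\<leftarrow>xs. b v w)"
proof -
  interpret V1: finite_dimensional_vector_space s1 B1 by (fact fd1)
  interpret V2: finite_dimensional_vector_space s2 B2 by (fact fd2)
  interpret U: vector_space s using lin1 by (simp add: Vector_Spaces.linear_iff)
  interpret K: vector_space "(*)" by unfold_locales (auto simp: algebra_simps)
  define c1 where "c1 = (\<lambda>d v. V1.representation B1 v d)"
  define c2 where "c2 = (\<lambda>e w. V2.representation B2 w e)"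
  have c1: "c1 d \<in> dual s1" for d
    using V1.independent_Basis V1.span_Basis V1.vector_space_axioms K.vector_space_axioms
    by (auto simp: dual_def c1_def Vector_Spaces.linear_iff V1.representation_add V1.representation_scale)
  have c2: "c2 e \<in> dual s2" for e
    using V2.independent_Basis V2.span_Basis V2.vector_space_axioms K.vector_space_axioms
    by (auto simp: dual_def c2_def Vector_Spaces.linear_iff V2.representation_add V2.representation_scale)
  have ex1: "v = (\<Sum>d\<in>B1. s1 (c1 d v) d)" for v
    using V1.sum_representation_eq[of B1 v B1] V1.independent_Basis V1.span_Basis V1.finite_Basis
    by (simp add: c1_def)
  have ex2: "w = (\<Sum>e\<in>B2. s2 (c2 e w) e)" for w
    using V2.sum_representation_eq[of B2 w B2] V2.independent_Basis V2.span_Basis V2.finite_Basis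
    by (simp add: c2_def)
  have b: "b v w = (\<Sum>d\<in>B1. \<Sum>e\<in>B2. s (c1 d v * c2 e w) (b d e))" for v w
  proof -
    interpret L1: Vector_Spaces.linear s1 s "\<lambda>v'. b v' w'" for w' by (fact lin1)
    interpret L2: Vector_Spaces.linear s2 s "b v'" for v' by (fact lin2)
    have "b v w = b (\<Sum>d\<in>B1. s1 (c1 d v) d) (\<Sum>e\<in>B2. s2 (c2 e w) e)"
      using ex1[of v] ex2[of w] by simp
    also have "\<dots> = (\<Sum>d\<in>B1. s (c1 d v) (b d (\<Sum>e\<in>B2. s2 (c2 e w) e)))"
      by (simp only: L1.sum L1.scale)
    also have "\<dots> = (\<Sum>d\<in>B1. s (c1 d v) (\<Sum>e\<in>B2. s (c2 e w) (b d e)))"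
      by (simp only: L2.sum L2.scale)
    finally show ?thesis by (simp add: U.scale_sum_right)
  qed
  have key: "(\<Sum>(v, w)\<leftarrow>ys. b v w) =
      (\<Sum>d\<in>B1. \<Sum>e\<in>B2. s (tensor_sum s1 s2 ys (c1 d) (c2 e)) (b d e))" for ys
  proof (induction ys)
    case Nil
    then show ?case by (simp add: tensor_sum_def)
  next
    case (Cons y ys)
    obtain v w where y: "y = (v, w)" by (cases y)
    show ?case
      using Cons b[of v w]
      by (simp add: y tensor_sum_apply[OF c1 c2] U.scale_left_distrib sum.distrib)
  qed
  show ?thesis
    unfolding tensor_lift_def by (rule the_equality) (auto simp: key)
qed

text \<open>\<open>V\<^sub>1\<^sup>\<or> \<otimes> V\<^sub>2\<^sup>\<or>\<close>, realised as a space of bilinear forms on \<open>V\<^sub>1 \<times> V\<^sub>2\<close>.\<close>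

definition dual_tensor_sum :: "(('v \<Rightarrow> 'k::field) \<times> ('w \<Rightarrow> 'k)) list \<Rightarrow> 'v \<Rightarrow> 'w \<Rightarrow> 'k" where
  "dual_tensor_sum xs = (\<lambda>v w. \<Sum>(f, g)\<leftarrow>xs. f v * g w)"

definition dual_tensor_space :: "('k::field \<Rightarrow> 'v::ab_group_add \<Rightarrow> 'v)
    \<Rightarrow> ('k \<Rightarrow> 'w::ab_group_add \<Rightarrow> 'w) \<Rightarrow> ('v \<Rightarrow> 'w \<Rightarrow> 'k) set" where
  "dual_tensor_space s1 s2 = {dual_tensor_sum xs | xs. set xs \<subseteq> dual s1 \<times> dual s2}"

definition tensor_rank :: "('k::field \<Rightarrow> 'v::ab_group_add \<Rightarrow> 'v)
    \<Rightarrow> ('k \<Rightarrow> 'w::ab_group_add \<Rightarrow> 'w) \<Rightarrow> ('v \<Rightarrow> 'w \<Rightarrow> 'k) \<Rightarrow> nat" where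
  "tensor_rank s1 s2 \<phi> =
    (LEAST r. \<exists>xs. length xs = r \<and> set xs \<subseteq> dual s1 \<times> dual s2 \<and> \<phi> = dual_tensor_sum xs)"

definition annihilator :: "('k::field \<Rightarrow> 'v::ab_group_add \<Rightarrow> 'v)
    \<Rightarrow> ('k \<Rightarrow> 'w::ab_group_add \<Rightarrow> 'w) \<Rightarrow> ('k, 'v, 'w) tensor set \<Rightarrow> ('v \<Rightarrow> 'w \<Rightarrow> 'k) set" where
  "annihilator s1 s2 K = {\<phi> \<in> dual_tensor_space s1 s2. \<forall>t\<in>K. tensor_lift s1 s2 \<phi> t = 0}"


section \<open>The biprojective space and its twisting sheaves\<close>

text \<open>For algebraically closed \<open>k\<close> we work with the classical variety of closed points. Its Zariski
  open sets, and the sheaves on it, correspond bijectively to those of the scheme.\<close>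

definition proj_point :: "('v \<Rightarrow> 'k::field) \<Rightarrow> ('v \<Rightarrow> 'k) set" where
  "proj_point f = {\<lambda>v. c * f v | c. c \<noteq> 0}"

type_synonym ('k, 'v, 'w) bipoint = "('v \<Rightarrow> 'k) set \<times> ('w \<Rightarrow> 'k) set"

text \<open>The bigraded piece \<open>Sym\<^sup>a(V\<^sub>1) \<otimes> Sym\<^sup>b(V\<^sub>2)\<close> of \<open>Sym(V\<^sub>1 \<oplus> V\<^sub>2)\<close>, as polynomial
  functions on \<open>V\<^sub>1\<^sup>\<or> \<times> V\<^sub>2\<^sup>\<or>\<close>; an algebraically closed field is infinite, so polynomials
  and polynomial functions agree. A vector is the linear function given by evaluation at it.\<close>

definition bihom :: "nat \<Rightarrow> nat \<Rightarrow> (('v \<Rightarrow> 'k::field) \<Rightarrow> ('w \<Rightarrow> 'k) \<Rightarrow> 'k) set" where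
  "bihom a b = module.span (\<lambda>c F f g. c * F f g)
     {\<lambda>f g. (\<Prod>v\<leftarrow>vs. f v) * (\<Prod>w\<leftarrow>ws. g w) | vs ws. length vs = a \<and> length ws = b}"

definition basic_open :: "('k::field \<Rightarrow> 'v::ab_group_add \<Rightarrow> 'v) \<Rightarrow> ('k \<Rightarrow> 'w::ab_group_add \<Rightarrow> 'w)
    \<Rightarrow> (('v \<Rightarrow> 'k) \<Rightarrow> ('w \<Rightarrow> 'k) \<Rightarrow> 'k) \<Rightarrow> ('k, 'v, 'w) bipoint set" where
  "basic_open s1 s2 F =
    {(proj_point f, proj_point g) | f g. f \<in> dual s1 - {0} \<and> g \<in> dual s2 - {0} \<and> F f g \<noteq> 0}"

text \<open>The Zariski topology on \<open>\<bbbP>V\<^sub>1 \<times> \<bbbP>V\<^sub>2\<close>; its underlying space is all of it, being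
  \<open>basic_open s1 s2 F\<close> for \<open>F = 1\<close>.\<close>

definition zariski :: "('k::field \<Rightarrow> 'v::ab_group_add \<Rightarrow> 'v) \<Rightarrow> ('k \<Rightarrow> 'w::ab_group_add \<Rightarrow> 'w)
    \<Rightarrow> ('k, 'v, 'w) bipoint topology" where
  "zariski s1 s2 = topology_generated_by {basic_open s1 s2 F | F a b. F \<in> bihom a b}"

definition cone :: "('k::field \<Rightarrow> 'v::ab_group_add \<Rightarrow> 'v) \<Rightarrow> ('k \<Rightarrow> 'w::ab_group_add \<Rightarrow> 'w)
    \<Rightarrow> ('k, 'v, 'w) bipoint set \<Rightarrow> (('v \<Rightarrow> 'k) \<times> ('w \<Rightarrow> 'k)) set" where
  "cone s1 s2 U =
    {(f, g). f \<in> dual s1 - {0} \<and> g \<in> dual s2 - {0} \<and> (proj_point f, proj_point g) \<in> U}"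

definition on_cone :: "('k::field \<Rightarrow> 'v::ab_group_add \<Rightarrow> 'v) \<Rightarrow> ('k \<Rightarrow> 'w::ab_group_add \<Rightarrow> 'w)
    \<Rightarrow> ('k, 'v, 'w) bipoint set \<Rightarrow> (('v \<Rightarrow> 'k) \<Rightarrow> ('w \<Rightarrow> 'k) \<Rightarrow> 'e::zero)
    \<Rightarrow> (('v \<Rightarrow> 'k) \<Rightarrow> ('w \<Rightarrow> 'k) \<Rightarrow> 'e)" where
  "on_cone s1 s2 U h = (\<lambda>f g. if (f, g) \<in> cone s1 s2 U then h f g else 0)"

text \<open>Sections of \<open>\<O>(a, b)\<close> over \<open>U\<close>: functions on the cone over \<open>U\<close> (extended by \<open>0\<close>) that are
  locally quotients of bihomogeneous polynomials with difference of bidegrees \<open>(a, b)\<close>.\<close>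

definition twist_sections :: "('k::field \<Rightarrow> 'v::ab_group_add \<Rightarrow> 'v)
    \<Rightarrow> ('k \<Rightarrow> 'w::ab_group_add \<Rightarrow> 'w) \<Rightarrow> nat \<Rightarrow> nat \<Rightarrow> ('k, 'v, 'w) bipoint set
    \<Rightarrow> (('v \<Rightarrow> 'k) \<Rightarrow> ('w \<Rightarrow> 'k) \<Rightarrow> 'k) set" where
  "twist_sections s1 s2 a b U =
    {\<sigma>. on_cone s1 s2 U \<sigma> = \<sigma> \<and>
        (\<forall>x\<in>U. \<exists>W c d. \<exists>F\<in>bihom (a + c) (b + d). \<exists>G\<in>bihom c d.
           openin (zariski s1 s2) W \<and> x \<in> W \<and> W \<subseteq> U \<and>
           (\<forall>(f, g)\<in>cone s1 s2 W. G f g \<noteq> 0 \<and> \<sigma> f g = F f g / G f g))}"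

text \<open>The sheaf \<open>E \<otimes> \<O>(a, b)\<close> for a finite-dimensional vector space \<open>E\<close>, a subspace of the type
  \<open>'e\<close> with scalar multiplication \<open>s\<close>: a section \<open>\<Sum>\<^sub>i e\<^sub>i \<otimes> \<sigma>\<^sub>i\<close> is identified with the
  \<open>E\<close>-valued function \<open>\<Sum>\<^sub>i \<sigma>\<^sub>i e\<^sub>i\<close>.\<close>

definition twist_sheaf :: "('k::field \<Rightarrow> 'v::ab_group_add \<Rightarrow> 'v) \<Rightarrow> ('k \<Rightarrow> 'w::ab_group_add \<Rightarrow> 'w)
    \<Rightarrow> ('k \<Rightarrow> 'e::ab_group_add \<Rightarrow> 'e) \<Rightarrow> 'e set \<Rightarrow> nat \<Rightarrow> nat
    \<Rightarrow> (('k, 'v, 'w) bipoint, ('v \<Rightarrow> 'k) \<Rightarrow> ('w \<Rightarrow> 'k) \<Rightarrow> 'e) presheaf" where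
  "twist_sheaf s1 s2 s E a b =
    \<lparr>base = zariski s1 s2,
     sections = (\<lambda>U.
       \<lparr>carrier = {\<lambda>f g. \<Sum>(e, \<sigma>)\<leftarrow>xs. s (\<sigma> f g) e | xs.
                     set xs \<subseteq> E \<times> twist_sections s1 s2 a b U},
        monoid.mult = (+), one = 0\<rparr>),
     restr = (\<lambda>U V. on_cone s1 s2 V)\<rparr>"


section \<open>The Koszul sheaf\<close>

text \<open>Both differentials are linear over the structure sheaf and so act pointwise on functions on
  the cone. At \<open>(f, g)\<close>, the term \<open>v\<^sub>1 \<otimes> v\<^sub>2\<close> of \<open>V\<^sub>1 \<otimes> \<O>(0, 1)\<close> takes the value
  \<open>g(v\<^sub>2) v\<^sub>1\<close>, and \<open>v\<^sub>2 \<otimes> v\<^sub>1\<close> in \<open>V\<^sub>2 \<otimes> \<O>(1, 0)\<close> the value \<open>f(v\<^sub>1) v\<^sub>2\<close>.\<close>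

definition koszul_alpha :: "('k::field \<Rightarrow> 'v::ab_group_add \<Rightarrow> 'v) \<Rightarrow> ('k \<Rightarrow> 'w::ab_group_add \<Rightarrow> 'w)
    \<Rightarrow> ('k, 'v, 'w) bipoint set \<Rightarrow> (('v \<Rightarrow> 'k) \<Rightarrow> ('w \<Rightarrow> 'k) \<Rightarrow> ('k, 'v, 'w) tensor)
    \<Rightarrow> (('v \<Rightarrow> 'k) \<Rightarrow> ('w \<Rightarrow> 'k) \<Rightarrow> 'v) \<times> (('v \<Rightarrow> 'k) \<Rightarrow> ('w \<Rightarrow> 'k) \<Rightarrow> 'w)" where
  "koszul_alpha s1 s2 U A =
    (on_cone s1 s2 U (\<lambda>f g. tensor_lift s1 s2 (\<lambda>v w. s1 (g w) v) (A f g)),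
     on_cone s1 s2 U (\<lambda>f g. - tensor_lift s1 s2 (\<lambda>v w. s2 (f v) w) (A f g)))"

definition koszul_beta :: "('k::field \<Rightarrow> 'v::ab_group_add \<Rightarrow> 'v) \<Rightarrow> ('k \<Rightarrow> 'w::ab_group_add \<Rightarrow> 'w)
    \<Rightarrow> ('k, 'v, 'w) bipoint set
    \<Rightarrow> (('v \<Rightarrow> 'k) \<Rightarrow> ('w \<Rightarrow> 'k) \<Rightarrow> 'v) \<times> (('v \<Rightarrow> 'k) \<Rightarrow> ('w \<Rightarrow> 'k) \<Rightarrow> 'w)
    \<Rightarrow> ('v \<Rightarrow> 'k) \<Rightarrow> ('w \<Rightarrow> 'k) \<Rightarrow> 'k" where
  "koszul_beta s1 s2 U = (\<lambda>(p, q). on_cone s1 s2 U (\<lambda>f g. f (p f g) + g (q f g)))"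

definition koszul_sheaf :: "('k::field \<Rightarrow> 'v::ab_group_add \<Rightarrow> 'v) \<Rightarrow> ('k \<Rightarrow> 'w::ab_group_add \<Rightarrow> 'w)
    \<Rightarrow> ('k, 'v, 'w) tensor set
    \<Rightarrow> (('k, 'v, 'w) bipoint,
        ('k, 'v, 'w) bipoint \<Rightarrow> (('k, 'v, 'w) bipoint set \<times>
          ((('v \<Rightarrow> 'k) \<Rightarrow> ('w \<Rightarrow> 'k) \<Rightarrow> 'v) \<times> (('v \<Rightarrow> 'k) \<Rightarrow> ('w \<Rightarrow> 'k) \<Rightarrow> 'w)) set) set)
       presheaf" where
  "koszul_sheaf s1 s2 K =
    homology_sheaf
      (twist_sheaf s1 s2 tensor_scale K 0 0)
      (koszul_alpha s1 s2)
      (direct_sum_sheaf (twist_sheaf s1 s2 s1 UNIV 0 1) (twist_sheaf s1 s2 s2 UNIV 1 0))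
      (koszul_beta s1 s2)
      (twist_sheaf s1 s2 (*) UNIV 1 1)"

end

theory Submission
  imports Defs "HOL-Analysis.Abstract_Limits" "HOL-Analysis.Product_Vector"
begin

text \<open>On the fibre at \<open>([f], [g])\<close> a functional \<open>(h\<^sub>1, h\<^sub>2)\<close> on \<open>V\<^sub>1 \<oplus> V\<^sub>2\<close> kills the image of
  \<open>K\<close> under \<open>\<alpha>\<close> exactly when \<open>h\<^sub>1 \<otimes> g - f \<otimes> h\<^sub>2\<close> lies in \<open>K\<^sup>\<bottom>\<close>, and this tensor vanishes exactly
  when \<open>(h\<^sub>1, h\<^sub>2)\<close> is a multiple of \<open>(f, g)\<close>. The tensors of this shape are those of rank at most
  two, so \<open>K\<^sup>\<bottom>\<close> contains no such non-zero tensor if and only if \<open>\<alpha>\<close> maps onto the fibre of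
  \<open>ker \<beta>\<close> at every point. Nakayama's lemma in the local rings turns this into local surjectivity
  of \<open>\<alpha>\<close> onto \<open>ker \<beta>\<close>. Conversely, the values of the global sections \<open>\<alpha>(v \<otimes> w)\<close> of \<open>ker \<beta>\<close>
  span each of its fibres, so lifting these sections near a point gives surjectivity there.\<close>

section \<open>Nakayama's lemma in a local ring of germs of functions\<close>

text \<open>A homology sheaf is a sheafified quotient, so its vanishing means local exactness: every
  cycle becomes a boundary near each point. Nakayama's lemma is not applied to the kernel of
  \<beta>, for which no generators near the point are at hand, but to the free module of regular
  functions with values in \<open>V\<^sub>1 \<oplus> V\<^sub>2\<close>. Division by linear forms
  that do not vanish at the point trivialises the twisting sheaves. One constant vector, of
  \<beta>-value 1, is added to the image of \<alpha> so that the values span the whole fibre; on a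
  cycle, \<beta> shows that its coefficient is zero. The local ring is kept as a set of functions on
  pairs of representatives, with identities required only eventually along a filter of
  neighbourhoods. Tensors of rank at most two need some care because the factors f and g must be
  non-zero to name a point. In the converse, \<open>v \<otimes> w\<close> is a pure tensor on which
  the given form does not vanish; it lies outside K, yet the formula for \<alpha> still sends it to
  a cycle.\<close>

locale function_local_ring =
  fixes F :: "'p filter" and x\<^sub>0 :: 'p and R :: "('p \<Rightarrow> 'k::field) set"
  assumes eventually_at: "eventually P F \<Longrightarrow> P x\<^sub>0"
    and const_mem: "(\<lambda>_. c) \<in> R"
    and add_mem: "r \<in> R \<Longrightarrow> r' \<in> R \<Longrightarrow> (\<lambda>x. r x + r' x) \<in> R"
    and mult_mem: "r \<in> R \<Longrightarrow> r' \<in> R \<Longrightarrow> (\<lambda>x. r x * r' x) \<in> R"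
    and inverse_mem: "r \<in> R \<Longrightarrow> r x\<^sub>0 \<noteq> 0 \<Longrightarrow> (\<lambda>x. inverse (r x)) \<in> R"
    and eventually_nonzero: "r \<in> R \<Longrightarrow> r x\<^sub>0 \<noteq> 0 \<Longrightarrow> eventually (\<lambda>x. r x \<noteq> 0) F"
begin

lemma diff_mem: "r \<in> R \<Longrightarrow> r' \<in> R \<Longrightarrow> (\<lambda>x. r x - r' x) \<in> R"
  using add_mem[OF _ mult_mem[OF const_mem, of r' "-1"], of r] by simp

text \<open>The variables \<open>u i\<close> are eliminated one at a time: the coefficient \<open>1 - a\<^sub>i\<^sub>i\<close> of
  \<open>u i\<close> in the \<open>i\<close>-th relation is a unit.\<close>

lemma nakayama_elimination:
  assumes "finite I" "vector_space s"
    and N_add: "\<And>m n. m \<in> N \<Longrightarrow> n \<in> N \<Longrightarrow> (\<lambda>x. m x + n x) \<in> N"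
    and N_scale: "\<And>r m. r \<in> R \<Longrightarrow> m \<in> N \<Longrightarrow> (\<lambda>x. s (r x) (m x)) \<in> N"
    and N_cong: "\<And>m n. m \<in> N \<Longrightarrow> eventually (\<lambda>x. n x = m x) F \<Longrightarrow> n \<in> N"
    and "\<And>i. i \<in> I \<Longrightarrow> \<exists>n\<in>N. \<exists>a. (\<forall>j\<in>I. a j \<in> R \<and> a j x\<^sub>0 = 0) \<and>
            eventually (\<lambda>x. u i x = n x + (\<Sum>j\<in>I. s (a j x) (u j x))) F"
  shows "\<forall>i\<in>I. u i \<in> N"
  using assms(1,6)
proof (induction I)
  case empty
  then show ?case by simp
next
  case (insert k I)
  interpret vector_space s by fact
  have sum_N: "(\<lambda>x. m x + (\<Sum>j\<in>J. s (b j x) (u j x))) \<in> N"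
    if "finite J" "m \<in> N" "\<forall>j\<in>J. b j \<in> R \<and> u j \<in> N" for J m b
    using that
  proof (induction J)
    case (insert j J)
    then have "(\<lambda>x. s (b j x) (u j x) + (m x + (\<Sum>j\<in>J. s (b j x) (u j x)))) \<in> N"
      by (intro N_add[OF N_scale]) auto
    moreover have "(\<lambda>x. m x + (\<Sum>j\<in>insert j J. s (b j x) (u j x))) =
        (\<lambda>x. s (b j x) (u j x) + (m x + (\<Sum>j\<in>J. s (b j x) (u j x))))"
      using insert.hyps by (simp add: fun_eq_iff add.left_commute)
    ultimately show ?case by (simp only:)
  qed simp
  from insert.prems[of k] obtain n a where n: "n \<in> N"
    and a: "\<And>j. j \<in> insert k I \<Longrightarrow> a j \<in> R" "\<And>j. j \<in> insert k I \<Longrightarrow> a j x\<^sub>0 = 0"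
    and ev: "eventually (\<lambda>x. u k x = n x + (\<Sum>j\<in>insert k I. s (a j x) (u j x))) F"
    by auto
  define c where "c x = inverse (1 - a k x)" for x
  have R1: "(\<lambda>x. 1 - a k x) \<in> R" by (intro diff_mem const_mem a) auto
  then have c: "c \<in> R" unfolding c_def by (intro inverse_mem) (auto simp: a)
  have "eventually (\<lambda>x. 1 - a k x \<noteq> 0) F"
    using R1 by (intro eventually_nonzero) (auto simp: a)
  with ev have uk: "eventually (\<lambda>x. u k x = s (c x) (n x) + (\<Sum>j\<in>I. s (c x * a j x) (u j x))) F"
  proof eventually_elim
    case (elim x)
    have "s (1 - a k x) (u k x) = n x + (\<Sum>j\<in>I. s (a j x) (u j x))"
      using elim(1) insert.hyps by (simp add: algebra_simps)
    then have "s (c x) (s (1 - a k x) (u k x)) = s (c x) (n x + (\<Sum>j\<in>I. s (a j x) (u j x)))"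
      by simp
    moreover have "c x * (1 - a k x) = 1" using elim(2) by (simp add: c_def)
    ultimately show ?case by (simp add: scale_right_distrib scale_sum_right)
  qed
  \<comment> \<open>Substituting the expression for \<open>u k\<close> into the \<open>i\<close>-th
    relation leaves a relation among the variables in \<open>I\<close>. Its coefficients
    \<open>a' j + a' k * c * a j\<close> still vanish at the base point, so the induction hypothesis
    applies.\<close>
  have I: "\<forall>i\<in>I. u i \<in> N"
  proof (rule insert.IH)
    fix i assume i: "i \<in> I"
    with insert.prems[of i] obtain n' a' where n': "n' \<in> N"
      and a': "\<And>j. j \<in> insert k I \<Longrightarrow> a' j \<in> R" "\<And>j. j \<in> insert k I \<Longrightarrow> a' j x\<^sub>0 = 0"
      and ev': "eventually (\<lambda>x. u i x = n' x + (\<Sum>j\<in>insert k I. s (a' j x) (u j x))) F"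
      by auto
    have "eventually (\<lambda>x. u i x = n' x + s (a' k x * c x) (n x) +
        (\<Sum>j\<in>I. s (a' j x + a' k x * (c x * a j x)) (u j x))) F"
      using ev' uk
    proof eventually_elim
      case (elim x)
      have "u i x = n' x + s (a' k x) (u k x) + (\<Sum>j\<in>I. s (a' j x) (u j x))"
        using elim(1) insert.hyps by (simp add: algebra_simps)
      also have "s (a' k x) (u k x) = s (a' k x * c x) (n x) +
          (\<Sum>j\<in>I. s (a' k x * (c x * a j x)) (u j x))"
        by (subst elim(2)) (simp add: scale_right_distrib scale_sum_right)
      finally show ?case by (simp add: scale_left_distrib sum.distrib algebra_simps)
    qed
    moreover have "(\<lambda>x. n' x + s (a' k x * c x) (n x)) \<in> N"
      by (intro N_add N_scale n' n mult_mem a' c) auto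
    moreover have "\<forall>j\<in>I. (\<lambda>x. a' j x + a' k x * (c x * a j x)) \<in> R \<and>
        a' j x\<^sub>0 + a' k x\<^sub>0 * (c x\<^sub>0 * a j x\<^sub>0) = 0"
      by (auto intro!: add_mem mult_mem a a' c simp: a(2) a'(2))
    ultimately show "\<exists>n\<in>N. \<exists>a. (\<forall>j\<in>I. a j \<in> R \<and> a j x\<^sub>0 = 0) \<and>
        eventually (\<lambda>x. u i x = n x + (\<Sum>j\<in>I. s (a j x) (u j x))) F"
      by (intro bexI[of _ "\<lambda>x. n' x + s (a' k x * c x) (n x)"]
          exI[of _ "\<lambda>j x. a' j x + a' k x * (c x * a j x)"]) auto
  qed
  \<comment> \<open>Back substitution: the remaining variables are now known to lie in
    \<open>N\<close>, hence so does the expression for \<open>u k\<close>.\<close>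
  have "(\<lambda>x. s (c x) (n x) + (\<Sum>j\<in>I. s (c x * a j x) (u j x))) \<in> N"
    by (intro sum_N N_scale insert.hyps c n) (auto intro!: mult_mem c a simp: I)
  with uk have "u k \<in> N" by (rule N_cong[rotated])
  with I show ?case by simp
qed

text \<open>This is the submodule generated by \<open>D\<close> over the local ring, seen as
  functions that are constrained only near the base point. For \<open>D\<close> the constant
  functions it is the module of regular vector-valued functions, which finitely many constants
  generate when the space is finite dimensional.\<close>

definition combinations :: "('k \<Rightarrow> 'e::ab_group_add \<Rightarrow> 'e) \<Rightarrow> ('p \<Rightarrow> 'e) set \<Rightarrow> ('p \<Rightarrow> 'e) set" where
  "combinations s D = {m. \<exists>xs. set xs \<subseteq> D \<times> R \<and>
     eventually (\<lambda>x. m x = (\<Sum>(u, r)\<leftarrow>xs. s (r x) (u x))) F}"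

lemma combinations_cong:
  assumes "m \<in> combinations s D" "eventually (\<lambda>x. n x = m x) F"
  shows "n \<in> combinations s D"
proof -
  from assms(1) obtain xs where "set xs \<subseteq> D \<times> R"
    and "eventually (\<lambda>x. m x = (\<Sum>(u, r)\<leftarrow>xs. s (r x) (u x))) F"
    by (auto simp: combinations_def)
  moreover from this(2) assms(2) have "eventually (\<lambda>x. n x = (\<Sum>(u, r)\<leftarrow>xs. s (r x) (u x))) F"
    by eventually_elim simp
  ultimately show ?thesis by (auto simp: combinations_def)
qed

lemma combinations_zero: "(\<lambda>_. 0) \<in> combinations s D"
  by (auto simp: combinations_def intro!: exI[of _ "[]"])

lemma combinations_add:
  assumes "m \<in> combinations s D" "n \<in> combinations s D"
  shows "(\<lambda>x. m x + n x) \<in> combinations s D"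
proof -
  from assms obtain xs ys where "set xs \<subseteq> D \<times> R" "set ys \<subseteq> D \<times> R"
    and ev: "eventually (\<lambda>x. m x = (\<Sum>(u, r)\<leftarrow>xs. s (r x) (u x))) F"
      "eventually (\<lambda>x. n x = (\<Sum>(u, r)\<leftarrow>ys. s (r x) (u x))) F"
    by (auto simp: combinations_def)
  moreover from ev have "eventually (\<lambda>x. m x + n x = (\<Sum>(u, r)\<leftarrow>xs @ ys. s (r x) (u x))) F"
    by eventually_elim simp
  ultimately show ?thesis by (auto simp: combinations_def intro!: exI[of _ "xs @ ys"])
qed

lemma combinations_scale:
  assumes "vector_space s" "r \<in> R" "m \<in> combinations s D"
  shows "(\<lambda>x. s (r x) (m x)) \<in> combinations s D"
proof -
  interpret vector_space s by fact
  from assms obtain xs where "set xs \<subseteq> D \<times> R"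
    and ev: "eventually (\<lambda>x. m x = (\<Sum>(u, r)\<leftarrow>xs. s (r x) (u x))) F"
    by (auto simp: combinations_def)
  moreover have *: "s (r x) (\<Sum>(u, r)\<leftarrow>xs. s (r x) (u x)) =
      (\<Sum>(u, r)\<leftarrow>map (\<lambda>(u, r'). (u, \<lambda>x. r x * r' x)) xs. s (r x) (u x))" for x
    by (induction xs) (auto simp: scale_right_distrib)
  from ev have "eventually (\<lambda>x. s (r x) (m x) =
      (\<Sum>(u, r)\<leftarrow>map (\<lambda>(u, r'). (u, \<lambda>x. r x * r' x)) xs. s (r x) (u x))) F"
    by eventually_elim (simp only: *)
  moreover have "set (map (\<lambda>(u, r'). (u, \<lambda>x. r x * r' x)) xs) \<subseteq> D \<times> R"
    using calculation(1) assms(2) by (auto intro!: mult_mem)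
  ultimately show ?thesis unfolding combinations_def by blast
qed

lemma combinations_base:
  assumes "vector_space s" "u \<in> D"
  shows "u \<in> combinations s D"
proof -
  interpret vector_space s by fact
  show ?thesis
    using assms const_mem by (auto simp: combinations_def intro!: exI[of _ "[(u, \<lambda>_. 1)]"])
qed

lemma combinations_trans:
  assumes "vector_space s" "D \<subseteq> combinations s D'"
  shows "combinations s D \<subseteq> combinations s D'"
proof
  fix m assume "m \<in> combinations s D"
  then obtain xs where xs: "set xs \<subseteq> D \<times> R"
    and ev: "eventually (\<lambda>x. m x = (\<Sum>(u, r)\<leftarrow>xs. s (r x) (u x))) F"
    by (auto simp: combinations_def)
  from xs have "(\<lambda>x. (\<Sum>(u, r)\<leftarrow>xs. s (r x) (u x))) \<in> combinations s D'"
  proof (induction xs)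
    case (Cons y xs)
    then show ?case
      using assms by (cases y) (auto intro!: combinations_add combinations_scale)
  qed (simp add: combinations_zero)
  then show "m \<in> combinations s D'" using ev by (rule combinations_cong)
qed

text \<open>Each coefficient splits as its value at the base point plus a function in the maximal
  ideal. The values add up to \<open>m\<close> at the base point; the remainders are expanded in the
  spanning set \<open>B\<close>. In other words, a regular vector function is constant modulo the
  maximal ideal.\<close>

lemma combinations_const_expansion:
  assumes "vector_space s" "finite B" "module.span s B = UNIV"
    and "m \<in> combinations s (range (\<lambda>e _. e))"
  shows "\<exists>a. (\<forall>b\<in>B. a b \<in> R \<and> a b x\<^sub>0 = 0) \<and>
    eventually (\<lambda>x. m x = m x\<^sub>0 + (\<Sum>b\<in>B. s (a b x) b)) F"
proof -
  interpret vector_space s by fact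
  from assms obtain xs where "set xs \<subseteq> range (\<lambda>e _. e) \<times> R"
    and ev: "eventually (\<lambda>x. m x = (\<Sum>(u, r)\<leftarrow>xs. s (r x) (u x))) F"
    by (auto simp: combinations_def)
  from this(1) have "\<exists>a. (\<forall>b\<in>B. a b \<in> R \<and> a b x\<^sub>0 = 0) \<and>
    (\<forall>x. (\<Sum>(u, r)\<leftarrow>xs. s (r x) (u x)) =
       (\<Sum>(u, r)\<leftarrow>xs. s (r x\<^sub>0) (u x\<^sub>0)) + (\<Sum>b\<in>B. s (a b x) b))"
  proof (induction xs)
    case Nil
    show ?case by (rule exI[of _ "\<lambda>_ _. 0"]) (auto intro: const_mem)
  next
    case (Cons y xs)
    have "set xs \<subseteq> range (\<lambda>e _. e) \<times> R" using Cons.prems by simp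
    from Cons.IH[OF this] obtain a where a: "\<forall>b\<in>B. a b \<in> R \<and> a b x\<^sub>0 = 0"
      "\<And>x. (\<Sum>(u, r)\<leftarrow>xs. s (r x) (u x)) =
         (\<Sum>(u, r)\<leftarrow>xs. s (r x\<^sub>0) (u x\<^sub>0)) + (\<Sum>b\<in>B. s (a b x) b)"
      by blast
    from Cons.prems obtain e r where y: "y = (\<lambda>_. e, r)" and r: "r \<in> R" by auto
    have "e \<in> span B" using assms by simp
    then obtain c where c: "e = (\<Sum>b\<in>B. s (c b) b)" using span_finite[OF assms(2)] by auto
    have "(\<Sum>(u, r)\<leftarrow>y # xs. s (r x) (u x)) = (\<Sum>(u, r)\<leftarrow>y # xs. s (r x\<^sub>0) (u x\<^sub>0)) +
       (\<Sum>b\<in>B. s (a b x + (r x - r x\<^sub>0) * c b) b)" for x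
    proof -
      have "s (r x) e = s (r x\<^sub>0) e + s (r x - r x\<^sub>0) e" by (simp add: algebra_simps)
      also have "s (r x - r x\<^sub>0) e = (\<Sum>b\<in>B. s ((r x - r x\<^sub>0) * c b) b)"
        by (subst c) (simp add: scale_sum_right)
      finally show ?thesis
        by (simp add: y a(2)[of x] scale_left_distrib sum.distrib ac_simps)
    qed
    moreover have "(\<lambda>x. a b x + (r x - r x\<^sub>0) * c b) \<in> R" if "b \<in> B" for b
      using a(1) that by (intro add_mem mult_mem[OF diff_mem] r const_mem) auto
    moreover have "a b x\<^sub>0 + (r x\<^sub>0 - r x\<^sub>0) * c b = 0" if "b \<in> B" for b
      using a(1) that by simp
    ultimately show ?case
      by (intro exI[of _ "\<lambda>b x. a b x + (r x - r x\<^sub>0) * c b"] conjI allI ballI)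
  qed
  then obtain a where a: "\<forall>b\<in>B. a b \<in> R \<and> a b x\<^sub>0 = 0" "\<And>x. (\<Sum>(u, r)\<leftarrow>xs. s (r x) (u x)) =
       (\<Sum>(u, r)\<leftarrow>xs. s (r x\<^sub>0) (u x\<^sub>0)) + (\<Sum>b\<in>B. s (a b x) b)" by auto
  \<comment> \<open>The base point belongs to each of its neighbourhoods, so an identity that holds
    nearby may be evaluated there.\<close>
  have "m x\<^sub>0 = (\<Sum>(u, r)\<leftarrow>xs. s (r x\<^sub>0) (u x\<^sub>0))" using eventually_at[OF ev] .
  then have "m x = m x\<^sub>0 + (\<Sum>b\<in>B. s (a b x) b)" if "m x = (\<Sum>(u, r)\<leftarrow>xs. s (r x) (u x))" for x
    using a(2)[of x] that by simp
  with ev have "eventually (\<lambda>x. m x = m x\<^sub>0 + (\<Sum>b\<in>B. s (a b x) b)) F"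
    by (rule eventually_mono)
  with a(1) show ?thesis by blast
qed

text \<open>Generators of the fibre at the base point generate near it. Each \<open>b\<close> in
  \<open>B\<close> is the value there of some \<open>n\<close> generated by \<open>D\<close>, and
  the expansion of \<open>n\<close> about the base point writes \<open>b\<close> as \<open>n\<close>
  plus a combination of \<open>B\<close> with coefficients in the maximal ideal. These are the
  relations that \<open>nakayama_elimination\<close> solves, with the constant functions
  \<open>b\<close> as unknowns.\<close>

theorem nakayama:
  assumes "vector_space s" "finite B" "module.span s B = UNIV"
    and D: "D \<subseteq> combinations s (range (\<lambda>e _. e))"
    and span: "module.span s ((\<lambda>u. u x\<^sub>0) ` D) = UNIV"
  shows "combinations s (range (\<lambda>e _. e)) \<subseteq> combinations s D"
proof -
  interpret vector_space s by fact
  let ?C = "range (\<lambda>e _. e) :: ('p \<Rightarrow> _) set"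
  note [intro] = combinations_scale combinations_zero combinations_base
    const_mem \<open>vector_space s\<close>
  \<comment> \<open>A linear combination of the values that yields \<open>e\<close> is applied, with
    the same constant coefficients, to the functions themselves.\<close>
  have lift: "\<exists>n\<in>combinations s D. n \<in> combinations s ?C \<and> n x\<^sub>0 = e" for e
  proof -
    have "e \<in> module.span s ((\<lambda>u. u x\<^sub>0) ` D)" using span by simp
    then show ?thesis
    proof (induction e rule: span_induct_alt)
      case base
      show ?case by (rule bexI[of _ "\<lambda>_. 0"]) auto
    next
      case (step c y z)
      then obtain u n where "u \<in> D" "y = u x\<^sub>0" "n \<in> combinations s D" "n \<in> combinations s ?C"
        "n x\<^sub>0 = z" by auto
      moreover have "(\<lambda>x. s c (u x) + n x) \<in> combinations s D"
        "(\<lambda>x. s c (u x) + n x) \<in> combinations s ?C"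
        using calculation D
        by (auto intro!: combinations_add combinations_scale[OF \<open>vector_space s\<close> const_mem])
      ultimately show ?case by (intro bexI[of _ "\<lambda>x. s c (u x) + n x"]) auto
    qed
  qed
  have B: "\<forall>b\<in>B. (\<lambda>_. b) \<in> combinations s D"
  proof (rule nakayama_elimination)
    fix b assume "b \<in> B"
    from lift[of b] obtain n where n: "n \<in> combinations s D" "n \<in> combinations s ?C" "n x\<^sub>0 = b"
      by auto
    obtain a where a: "\<forall>j\<in>B. a j \<in> R \<and> a j x\<^sub>0 = 0"
      and ev: "eventually (\<lambda>x. n x = n x\<^sub>0 + (\<Sum>j\<in>B. s (a j x) j)) F"
      using combinations_const_expansion[OF assms(1-3) n(2)] by auto
    from ev have "eventually (\<lambda>x. b = n x + (\<Sum>j\<in>B. s (- a j x) j)) F"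
      by eventually_elim (simp add: n(3) sum_negf)
    moreover have "\<forall>j\<in>B. (\<lambda>x. - a j x) \<in> R \<and> - a j x\<^sub>0 = 0"
      using a diff_mem[OF const_mem, of _ 0] by simp
    ultimately show "\<exists>n\<in>combinations s D. \<exists>a. (\<forall>j\<in>B. a j \<in> R \<and> a j x\<^sub>0 = 0) \<and>
        eventually (\<lambda>x. b = n x + (\<Sum>j\<in>B. s (a j x) j)) F"
      using n(1) by (intro bexI[of _ n] exI[of _ "\<lambda>j x. - a j x"]) auto
  qed (use assms in \<open>auto intro: combinations_cong combinations_add combinations_scale\<close>)
  have "(\<lambda>_. e) \<in> combinations s D" for e
  proof -
    have "e \<in> module.span s B" using assms by simp
    then show ?thesis
    proof (induction e rule: span_induct_alt)
      case (step c x y)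
      then show ?case
        using B
        by (auto intro!: combinations_add combinations_scale[OF \<open>vector_space s\<close> const_mem])
    qed auto
  qed
  then show ?thesis by (intro combinations_trans) auto
qed

end

section \<open>Bihomogeneous polynomials and the Zariski topology\<close>

lemma module_bihom: "module (\<lambda>(c::'k::field) F (f::'v \<Rightarrow> 'k) (g::'w \<Rightarrow> 'k). c * F f g)"
  by unfold_locales (auto simp: fun_eq_iff algebra_simps)

lemma bihom_monomial:
  "length vs = a \<Longrightarrow> length ws = b \<Longrightarrow> (\<lambda>f g. (\<Prod>v\<leftarrow>vs. f v) * (\<Prod>w\<leftarrow>ws. g w)) \<in> bihom a b"
  unfolding bihom_def by (rule module.span_base[OF module_bihom]) blast

lemma bihom_zero: "(\<lambda>_ _. 0) \<in> bihom a b"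
  using module.span_zero[OF module_bihom] by (auto simp: bihom_def zero_fun_def)

lemma bihom_add: "F \<in> bihom a b \<Longrightarrow> G \<in> bihom a b \<Longrightarrow> (\<lambda>f g. F f g + G f g) \<in> bihom a b"
  using module.span_add[OF module_bihom, of F _ G] by (auto simp: bihom_def plus_fun_def)

lemma bihom_scale: "F \<in> bihom a b \<Longrightarrow> (\<lambda>f g. c * F f g) \<in> bihom a b"
  using module.span_scale[OF module_bihom, of F _ c] by (auto simp: bihom_def)

lemma bihom_induct [consumes 1, case_names zero step]:
  fixes F :: "('v \<Rightarrow> 'k::field) \<Rightarrow> ('w \<Rightarrow> 'k) \<Rightarrow> 'k"
  assumes "F \<in> bihom a b" "P (\<lambda>_ _. 0)"
    and "\<And>c vs ws G. length vs = a \<Longrightarrow> length ws = b \<Longrightarrow> P G \<Longrightarrow>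
           P (\<lambda>f g. c * ((\<Prod>v\<leftarrow>vs. f v) * (\<Prod>w\<leftarrow>ws. g w)) + G f g)"
  shows "P F"
  using assms(1) unfolding bihom_def
proof (induction F rule: module.span_induct_alt[OF module_bihom, consumes 1])
  case 1
  then show ?case using assms(2) by (simp add: zero_fun_def)
next
  case (2 c F G)
  then show ?case using assms(3)[of _ _ G c] by (auto simp: plus_fun_def)
qed

lemma bihom_mult:
  assumes "F \<in> bihom a b" "G \<in> bihom c d"
  shows "(\<lambda>f g. F f g * G f g) \<in> bihom (a + c) (b + d)"
  using assms(1)
proof (induction F rule: bihom_induct)
  case zero
  then show ?case by (simp add: bihom_zero)
next
  case (step e vs ws H)
  have "(\<lambda>f g. ((\<Prod>v\<leftarrow>vs. f v) * (\<Prod>w\<leftarrow>ws. g w)) * G f g) \<in> bihom (a + c) (b + d)"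
    using assms(2)
  proof (induction G rule: bihom_induct)
    case zero
    then show ?case by (simp add: bihom_zero)
  next
    case (step e' vs' ws' H')
    have "(\<lambda>f g. e' * ((\<Prod>v\<leftarrow>vs @ vs'. f v) * (\<Prod>w\<leftarrow>ws @ ws'. g w)) +
        (\<Prod>v\<leftarrow>vs. f v) * (\<Prod>w\<leftarrow>ws. g w) * H' f g) \<in> bihom (a + c) (b + d)"
      using step \<open>length vs = a\<close> \<open>length ws = b\<close>
      by (intro bihom_add bihom_scale bihom_monomial) auto
    then show ?case by (simp add: algebra_simps)
  qed
  from bihom_add[OF bihom_scale[OF this, of e] step.IH] show ?case
    by (simp add: algebra_simps)
qed

lemma bihom_const: "(\<lambda>_ _. c) \<in> bihom 0 0"
  using bihom_scale[OF bihom_monomial[of "[]" 0 "[]" 0], of c] by simp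

lemma bihom_eval_left: "(\<lambda>f _. f v) \<in> bihom 1 0"
  using bihom_monomial[of "[v]" 1 "[]" 0] by simp

lemma bihom_eval_right: "(\<lambda>_ g. g w) \<in> bihom 0 1"
  using bihom_monomial[of "[]" 0 "[w]" 1] by simp

lemma bihom_homogeneous:
  "F \<in> bihom a b \<Longrightarrow> F (\<lambda>v. c * f v) (\<lambda>w. d * g w) = c ^ a * d ^ b * F f g"
proof (induction F rule: bihom_induct)
  case (step e vs ws G)
  have "(\<Prod>v\<leftarrow>vs. c * f v) = c ^ a * (\<Prod>v\<leftarrow>vs. f v)"
    using \<open>length vs = a\<close> by (induction vs arbitrary: a) auto
  moreover have "(\<Prod>w\<leftarrow>ws. d * g w) = d ^ b * (\<Prod>w\<leftarrow>ws. g w)"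
    using \<open>length ws = b\<close> by (induction ws arbitrary: b) auto
  ultimately show ?case using step by (simp add: algebra_simps)
qed simp

section \<open>Points, cones of representatives and the neighbourhood filter on the cone\<close>

lemma proj_point_eqD: "proj_point f = proj_point f' \<Longrightarrow> \<exists>c. c \<noteq> 0 \<and> f' = (\<lambda>v. c * f v)"
proof -
  assume "proj_point f = proj_point f'"
  moreover have "f' \<in> proj_point f'" by (auto simp: proj_point_def intro!: exI[of _ 1])
  ultimately show ?thesis by (auto simp: proj_point_def)
qed

lemma openin_basic_open: "F \<in> bihom a b \<Longrightarrow> openin (zariski s1 s2) (basic_open s1 s2 F)"
  unfolding zariski_def by (rule topology_generated_by_Basis) blast

lemma topspace_zariski: "topspace (zariski s1 s2) = basic_open s1 s2 (\<lambda>_ _. 1)"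
proof -
  have "basic_open s1 s2 F \<subseteq> basic_open s1 s2 (\<lambda>_ _. 1)" for F
    by (auto simp: basic_open_def)
  moreover have "basic_open s1 s2 (\<lambda>_ _. 1) \<in> {basic_open s1 s2 F | F a b. F \<in> bihom a b}"
    using bihom_const[of 1] by blast
  ultimately show ?thesis unfolding zariski_def topology_generated_by_topspace by blast
qed

lemma mem_cone: "x \<in> cone s1 s2 U \<longleftrightarrow> fst x \<in> dual s1 - {0} \<and> snd x \<in> dual s2 - {0} \<and>
    (proj_point (fst x), proj_point (snd x)) \<in> U"
  by (cases x) (auto simp: cone_def)

text \<open>Rescaling the two representatives multiplies \<open>F\<close> by a non-zero scalar, by
  bihomogeneity. So the condition \<open>F \<noteq> 0\<close>, which a basic open set imposes on
  some pair of representatives, holds for all of them.\<close>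

lemma cone_basic_open:
  assumes "F \<in> bihom a b"
  shows "cone s1 s2 (basic_open s1 s2 F) =
    {x. fst x \<in> dual s1 - {0} \<and> snd x \<in> dual s2 - {0} \<and> F (fst x) (snd x) \<noteq> 0}"
proof -
  have "F f g \<noteq> 0" if "proj_point f = proj_point f'" "proj_point g = proj_point g'" "F f' g' \<noteq> 0"
    for f f' g g'
    using proj_point_eqD[OF that(1)] proj_point_eqD[OF that(2)] that(3)
    by (auto simp: bihom_homogeneous[OF assms])
  then show ?thesis by (fastforce simp: mem_cone basic_open_def)
qed

text \<open>Regular functions and sections are functions of representatives, so the neighbourhood
  filter of the point is pulled back to pairs of functionals. The principal part keeps only pairs of
  non-zero linear functionals, those that represent points.\<close>

definition cone_nhds :: "('k::field \<Rightarrow> 'v::ab_group_add \<Rightarrow> 'v) \<Rightarrow> ('k \<Rightarrow> 'w::ab_group_add \<Rightarrow> 'w)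
    \<Rightarrow> ('k, 'v, 'w) bipoint \<Rightarrow> (('v \<Rightarrow> 'k) \<times> ('w \<Rightarrow> 'k)) filter" where
  "cone_nhds s1 s2 p = inf
     (filtercomap (\<lambda>(f, g). (proj_point f, proj_point g)) (nhdsin (zariski s1 s2) p))
     (principal ((dual s1 - {0}) \<times> (dual s2 - {0})))"

lemma eventually_cone_nhds:
  assumes "p \<in> topspace (zariski s1 s2)"
  shows "eventually P (cone_nhds s1 s2 p) \<longleftrightarrow>
    (\<exists>W. openin (zariski s1 s2) W \<and> p \<in> W \<and> (\<forall>x\<in>cone s1 s2 W. P x))" (is "?L \<longleftrightarrow> ?R")
proof
  assume ?L
  then obtain Q W where "\<And>x. Q (case x of (f, g) \<Rightarrow> (proj_point f, proj_point g)) \<Longrightarrow>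
      x \<in> (dual s1 - {0}) \<times> (dual s2 - {0}) \<Longrightarrow> P x"
    "openin (zariski s1 s2) W" "p \<in> W" "\<forall>q\<in>W. Q q"
    using assms
    by (auto simp: cone_nhds_def eventually_inf_principal eventually_filtercomap eventually_nhdsin)
  then show ?R by (intro exI[of _ W]) (auto simp: mem_cone split_beta)
next
  assume ?R
  then obtain W where W: "openin (zariski s1 s2) W" "p \<in> W" "\<forall>x\<in>cone s1 s2 W. P x" by auto
  then have "eventually (\<lambda>q. q \<in> W) (nhdsin (zariski s1 s2) p)"
    by (auto simp: eventually_nhdsin)
  then have "eventually (\<lambda>x. (case x of (f, g) \<Rightarrow> (proj_point f, proj_point g)) \<in> W)
      (filtercomap (\<lambda>(f, g). (proj_point f, proj_point g)) (nhdsin (zariski s1 s2) p))"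
    by (rule eventually_filtercomapI)
  then show ?L unfolding cone_nhds_def eventually_inf_principal
    by eventually_elim (use W(3) in \<open>auto simp: mem_cone\<close>)
qed

text \<open>The local ring of the product at the point. Numerator and denominator have the same
  bidegree, so the quotient depends only on the points that the representatives name; away from the
  given point the function is arbitrary.\<close>

definition regular_at :: "('k::field \<Rightarrow> 'v::ab_group_add \<Rightarrow> 'v) \<Rightarrow> ('k \<Rightarrow> 'w::ab_group_add \<Rightarrow> 'w)
    \<Rightarrow> (('v \<Rightarrow> 'k) \<times> ('w \<Rightarrow> 'k)) \<Rightarrow> (('v \<Rightarrow> 'k) \<times> ('w \<Rightarrow> 'k) \<Rightarrow> 'k) set" where
  "regular_at s1 s2 x\<^sub>0 = {r. \<exists>c d. \<exists>F\<in>bihom c d. \<exists>G\<in>bihom c d. G (fst x\<^sub>0) (snd x\<^sub>0) \<noteq> 0 \<and>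
     eventually (\<lambda>x. r x = F (fst x) (snd x) / G (fst x) (snd x))
       (cone_nhds s1 s2 (proj_point (fst x\<^sub>0), proj_point (snd x\<^sub>0)))}"

section \<open>The local ring at a closed point\<close>

locale cone_point =
  fixes s1 :: "'k::field \<Rightarrow> 'v::ab_group_add \<Rightarrow> 'v" and s2 :: "'k \<Rightarrow> 'w::ab_group_add \<Rightarrow> 'w"
    and f\<^sub>0 :: "'v \<Rightarrow> 'k" and g\<^sub>0 :: "'w \<Rightarrow> 'k"
  assumes f\<^sub>0: "f\<^sub>0 \<in> dual s1 - {0}" and g\<^sub>0: "g\<^sub>0 \<in> dual s2 - {0}"
begin

abbreviation "nearby \<equiv> cone_nhds s1 s2 (proj_point f\<^sub>0, proj_point g\<^sub>0)"

lemma mem_topspace: "(proj_point f\<^sub>0, proj_point g\<^sub>0) \<in> topspace (zariski s1 s2)"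
  using f\<^sub>0 g\<^sub>0 by (auto simp: topspace_zariski basic_open_def)

lemmas eventually_nearby = eventually_cone_nhds[OF mem_topspace]

lemma eventually_nearby_at: "eventually P nearby \<Longrightarrow> P (f\<^sub>0, g\<^sub>0)"
  using f\<^sub>0 g\<^sub>0 by (auto simp: eventually_nearby mem_cone)

lemma eventually_bihom_nonzero:
  assumes "G \<in> bihom c d" "G f\<^sub>0 g\<^sub>0 \<noteq> 0"
  shows "eventually (\<lambda>x. G (fst x) (snd x) \<noteq> 0) nearby"
proof -
  have "(proj_point f\<^sub>0, proj_point g\<^sub>0) \<in> basic_open s1 s2 G"
    using assms f\<^sub>0 g\<^sub>0 by (auto simp: basic_open_def)
  then show ?thesis
    using openin_basic_open[OF assms(1), of s1 s2] by (auto simp: eventually_nearby cone_basic_open[OF assms(1)])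
qed

lemma regularE:
  assumes "r \<in> regular_at s1 s2 (f\<^sub>0, g\<^sub>0)"
  obtains c d F G where "F \<in> bihom c d" "G \<in> bihom c d" "G f\<^sub>0 g\<^sub>0 \<noteq> 0"
    "eventually (\<lambda>x. G (fst x) (snd x) \<noteq> 0 \<and> r x = F (fst x) (snd x) / G (fst x) (snd x)) nearby"
proof -
  from assms obtain c d F G where "F \<in> bihom c d" "G \<in> bihom c d" "G f\<^sub>0 g\<^sub>0 \<noteq> 0"
    "eventually (\<lambda>x. r x = F (fst x) (snd x) / G (fst x) (snd x)) nearby"
    by (auto simp: regular_at_def)
  with eventually_bihom_nonzero[of G c d] show ?thesis
    by (intro that[of F c d G]) (auto simp: eventually_conj_iff)
qed

lemma regularI:
  assumes "F \<in> bihom c d" "G \<in> bihom c d" "G f\<^sub>0 g\<^sub>0 \<noteq> 0"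
    "eventually (\<lambda>x. r x = F (fst x) (snd x) / G (fst x) (snd x)) nearby"
  shows "r \<in> regular_at s1 s2 (f\<^sub>0, g\<^sub>0)"
  using assms by (auto simp: regular_at_def)

sublocale function_local_ring nearby "(f\<^sub>0, g\<^sub>0)" "regular_at s1 s2 (f\<^sub>0, g\<^sub>0)"
proof
  fix c :: 'k
  show "(\<lambda>_. c) \<in> regular_at s1 s2 (f\<^sub>0, g\<^sub>0)"
    by (rule regularI[OF bihom_const[of c] bihom_const[of 1]]) auto
next
  fix r r' assume "r \<in> regular_at s1 s2 (f\<^sub>0, g\<^sub>0)" "r' \<in> regular_at s1 s2 (f\<^sub>0, g\<^sub>0)"
  then obtain c d F G c' d' F' G' where
    r: "F \<in> bihom c d" "G \<in> bihom c d" "G f\<^sub>0 g\<^sub>0 \<noteq> 0"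
      "eventually (\<lambda>x. G (fst x) (snd x) \<noteq> 0 \<and> r x = F (fst x) (snd x) / G (fst x) (snd x)) nearby"
    and r': "F' \<in> bihom c' d'" "G' \<in> bihom c' d'" "G' f\<^sub>0 g\<^sub>0 \<noteq> 0"
      "eventually (\<lambda>x. G' (fst x) (snd x) \<noteq> 0 \<and> r' x = F' (fst x) (snd x) / G' (fst x) (snd x)) nearby"
    by (elim regularE)
  have FG': "(\<lambda>f g. F f g * G' f g) \<in> bihom (c + c') (d + d')"
    and GF': "(\<lambda>f g. G f g * F' f g) \<in> bihom (c + c') (d + d')"
    and FF': "(\<lambda>f g. F f g * F' f g) \<in> bihom (c + c') (d + d')"
    and GG': "(\<lambda>f g. G f g * G' f g) \<in> bihom (c + c') (d + d')"
    by (intro bihom_mult r r')+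
  show "(\<lambda>x. r x + r' x) \<in> regular_at s1 s2 (f\<^sub>0, g\<^sub>0)"
    by (rule regularI[OF bihom_add[OF FG' GF'] GG'])
      (use r(3) r'(3) eventually_conj[OF r(4) r'(4)] in
        \<open>auto elim!: eventually_mono simp: field_simps\<close>)
  show "(\<lambda>x. r x * r' x) \<in> regular_at s1 s2 (f\<^sub>0, g\<^sub>0)"
    by (rule regularI[OF FF' GG'])
      (use r(3) r'(3) eventually_conj[OF r(4) r'(4)] in \<open>auto elim!: eventually_mono\<close>)
next
  fix r assume "r \<in> regular_at s1 s2 (f\<^sub>0, g\<^sub>0)" and nz: "r (f\<^sub>0, g\<^sub>0) \<noteq> 0"
  then obtain c d F G where
    r: "F \<in> bihom c d" "G \<in> bihom c d" "G f\<^sub>0 g\<^sub>0 \<noteq> 0"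
      "eventually (\<lambda>x. G (fst x) (snd x) \<noteq> 0 \<and> r x = F (fst x) (snd x) / G (fst x) (snd x)) nearby"
    by (elim regularE)
  \<comment> \<open>A non-zero value at the base point forces the numerator to be non-zero there, so
    numerator and denominator may be exchanged.\<close>
  have F: "F f\<^sub>0 g\<^sub>0 \<noteq> 0" using eventually_nearby_at[OF r(4)] nz by auto
  show "(\<lambda>x. inverse (r x)) \<in> regular_at s1 s2 (f\<^sub>0, g\<^sub>0)"
    by (rule regularI[OF r(2,1) F]) (use r(4) in \<open>auto elim!: eventually_mono\<close>)
  show "eventually (\<lambda>x. r x \<noteq> 0) nearby"
    using eventually_conj[OF r(4) eventually_bihom_nonzero[OF r(1) F]]
    by (auto elim!: eventually_mono)
qed (rule eventually_nearby_at)

end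

section \<open>Tensors and linear functionals\<close>

lemma vector_space_field: "vector_space ((*) :: 'k::field \<Rightarrow> 'k \<Rightarrow> 'k)"
  by unfold_locales (auto simp: algebra_simps)

text \<open>A maximal independent subset of \<open>S\<close> stays independent when \<open>x\<close>
  is added, so a functional may be prescribed as 0 on that subset and 1 at \<open>x\<close>.\<close>

lemma (in vector_space) separating_functional:
  assumes "x \<notin> span S"
  shows "\<exists>h\<in>dual scale. (\<forall>y\<in>S. h y = 0) \<and> h x = 1"
proof -
  obtain B where B: "B \<subseteq> S" "independent B" "S \<subseteq> span B"
    using maximal_independent_subset[of S] by blast
  interpret K: vector_space "(*) :: 'a \<Rightarrow> 'a \<Rightarrow> 'a" by (rule vector_space_field)
  interpret vector_space_pair scale "(*) :: 'a \<Rightarrow> 'a \<Rightarrow> 'a" ..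
  have x: "x \<notin> span B" using assms span_mono[OF B(1)] by auto
  then have "independent (insert x B)" using B by (simp add: independent_insertI)
  then obtain h where h: "Vector_Spaces.linear scale (*) h"
    "\<forall>y\<in>insert x B. h y = (if y = x then 1 else 0)"
    using linear_independent_extend[of "insert x B" "\<lambda>y. if y = x then 1 else 0"] by blast
  have "x \<notin> B" using x span_base by blast
  with h(2) have "h y = 0" if "y \<in> B" for y using that by force
  then have "h y = 0" if "y \<in> S" for y
    using linear_eq_0_on_span[OF h(1)] that B(3) by blast
  moreover have "h x = 1" using h(2) by simp
  ultimately show ?thesis using h(1) unfolding dual_def by blast
qed

lemma dual_add: "f \<in> dual s \<Longrightarrow> f (x + y) = f x + f y"
  and dual_scale: "f \<in> dual s \<Longrightarrow> f (s c x) = c * f x"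
  and dual_zero: "f \<in> dual s \<Longrightarrow> f 0 = 0"
  and dual_minus: "f \<in> dual s \<Longrightarrow> f (- x) = - f x"
proof -
  assume "f \<in> dual s"
  then interpret Vector_Spaces.linear s "(*)" f by (simp add: dual_def)
  show "f (x + y) = f x + f y" "f (s c x) = c * f x" "f 0 = 0" "f (- x) = - f x"
    by (auto simp: add scale zero neg)
qed

lemma (in vector_space) dualI:
  assumes "\<And>x y. f (x + y) = f x + f y" "\<And>c x. f (scale c x) = c * f x"
  shows "f \<in> dual scale"
  using assms vector_space_axioms vector_space_field
  by (auto simp: dual_def Vector_Spaces.linear_iff)

section \<open>Bilinear maps on the tensor product and the rank of dual tensors\<close>

locale tensor_pair = finite_dimensional_vector_space_prod s1 s2 B1 B2
  for s1 :: "'k::field \<Rightarrow> 'v::ab_group_add \<Rightarrow> 'v" and s2 :: "'k \<Rightarrow> 'w::ab_group_add \<Rightarrow> 'w"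
    and B1 B2
begin

definition bilinear_map :: "('k \<Rightarrow> 'u::ab_group_add \<Rightarrow> 'u) \<Rightarrow> ('v \<Rightarrow> 'w \<Rightarrow> 'u) \<Rightarrow> bool" where
  "bilinear_map s b \<longleftrightarrow> (\<forall>w. Vector_Spaces.linear s1 s (\<lambda>v. b v w)) \<and>
     (\<forall>v. Vector_Spaces.linear s2 s (b v))"

lemma bilinear_mapI:
  assumes "vector_space s"
    and "\<And>v v' w. b (v + v') w = b v w + b v' w" "\<And>c v w. b (s1 c v) w = s c (b v w)"
    and "\<And>v w w'. b v (w + w') = b v w + b v w'" "\<And>c v w. b v (s2 c w) = s c (b v w)"
  shows "bilinear_map s b"
  using assms vs1.vector_space_axioms vs2.vector_space_axioms
  by (auto simp: bilinear_map_def Vector_Spaces.linear_iff)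

lemma tensor_lift_tensor_sum:
  "bilinear_map s b \<Longrightarrow> tensor_lift s1 s2 b (tensor_sum s1 s2 xs) = (\<Sum>(v, w)\<leftarrow>xs. b v w)"
  by (rule tensor_lift_sum[OF vs1.finite_dimensional_vector_space_axioms
        vs2.finite_dimensional_vector_space_axioms]) (auto simp: bilinear_map_def)

lemma tensor_sum_append:
  "tensor_sum s1 s2 (xs @ ys) = tensor_sum s1 s2 xs + tensor_sum s1 s2 ys"
  by (simp add: tensor_sum_def)

lemma tensor_scale_tensor_sum:
  "tensor_scale c (tensor_sum s1 s2 xs) = tensor_sum s1 s2 (map (\<lambda>(v, w). (s1 c v, w)) xs)"
proof (induction xs)
  case (Cons y xs)
  have "tensor_scale c (pure_tensor s1 s2 v w) = pure_tensor s1 s2 (s1 c v) w" for v w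
    by (auto simp: tensor_scale_def pure_tensor_def fun_eq_iff dual_scale)
  moreover have "tensor_scale c (t + t') = tensor_scale c t + tensor_scale c t'"
    for t t' :: "('k, 'v, 'w) tensor"
    by (simp add: tensor_scale_def fun_eq_iff distrib_left)
  ultimately show ?case using Cons
    by (cases y) (simp add: tensor_sum_def del: plus_fun_apply plus_fun_def)
qed (simp add: tensor_sum_def tensor_scale_def fun_eq_iff)

text \<open>This is the linearity of \<open>tensor_lift\<close>. Its defining description determines
  a value only at tensors that are represented by lists, so the induction also carries the fact that
  every partial sum is such a tensor.\<close>

lemma tensor_lift_combination:
  assumes b: "bilinear_map s b" and "set xs \<subseteq> tensor_space s1 s2 \<times> UNIV"
  shows "tensor_lift s1 s2 b (\<Sum>(t, c)\<leftarrow>xs. tensor_scale c t) =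
    (\<Sum>(t, c)\<leftarrow>xs. s c (tensor_lift s1 s2 b t))"
proof -
  interpret U: vector_space s using b by (auto simp: bilinear_map_def Vector_Spaces.linear_iff)
  have lin: "b (s1 c v) w = s c (b v w)" for c v w
    using b by (auto simp: bilinear_map_def Vector_Spaces.linear_iff)
  from assms(2) have "(\<Sum>(t, c)\<leftarrow>xs. tensor_scale c t) \<in> tensor_space s1 s2 \<and> ?thesis"
  proof (induction xs)
    case Nil
    have "tensor_sum s1 s2 [] = 0" by (simp add: tensor_sum_def)
    then show ?case
      using tensor_lift_tensor_sum[OF b, of "[]"] rangeI[of "tensor_sum s1 s2" "[]"]
      by (simp add: tensor_space_def del: zero_fun_apply zero_fun_def)
  next
    case (Cons y xs)
    obtain t c where y: "y = (t, c)" by (cases y)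
    from Cons obtain ys zs where "t = tensor_sum s1 s2 ys"
      and zs: "(\<Sum>(t, c)\<leftarrow>xs. tensor_scale c t) = tensor_sum s1 s2 zs"
      by (auto simp: y tensor_space_def)
    moreover have "(\<Sum>(v, w)\<leftarrow>map (\<lambda>(v, w). (s1 c v, w)) ys. b v w) = s c (\<Sum>(v, w)\<leftarrow>ys. b v w)"
      by (induction ys) (auto simp: lin U.scale_right_distrib)
    ultimately have "(\<Sum>(t, c)\<leftarrow>y # xs. tensor_scale c t) =
          tensor_sum s1 s2 (map (\<lambda>(v, w). (s1 c v, w)) ys @ zs)"
      and "tensor_lift s1 s2 b (tensor_sum s1 s2 (map (\<lambda>(v, w). (s1 c v, w)) ys @ zs)) =
        s c (tensor_lift s1 s2 b t) + tensor_lift s1 s2 b (tensor_sum s1 s2 zs)"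
      by (simp add: y tensor_sum_append tensor_scale_tensor_sum, simp add: tensor_lift_tensor_sum[OF b])
    then show ?case using Cons zs by (auto simp: y tensor_space_def simp del: map_append)
  qed
  then show ?thesis ..
qed

lemma bilinear_left: "g \<in> dual s2 \<Longrightarrow> bilinear_map s1 (\<lambda>v w. s1 (g w) v)"
  by (intro bilinear_mapI vs1.vector_space_axioms)
    (auto simp: dual_add dual_scale algebra_simps)

lemma bilinear_right: "f \<in> dual s1 \<Longrightarrow> bilinear_map s2 (\<lambda>v w. s2 (f v) w)"
  by (intro bilinear_mapI vs2.vector_space_axioms)
    (auto simp: dual_add dual_scale algebra_simps)

lemma bilinear_dual_tensor_sum:
  "set xs \<subseteq> dual s1 \<times> dual s2 \<Longrightarrow> bilinear_map (*) (dual_tensor_sum xs)"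
proof (intro bilinear_mapI vector_space_field)
  assume xs: "set xs \<subseteq> dual s1 \<times> dual s2"
  fix v v' w w' c
  show "dual_tensor_sum xs (v + v') w = dual_tensor_sum xs v w + dual_tensor_sum xs v' w"
    using xs by (induction xs) (auto simp: dual_tensor_sum_def dual_add algebra_simps)
  show "dual_tensor_sum xs (s1 c v) w = c * dual_tensor_sum xs v w"
    using xs by (induction xs) (auto simp: dual_tensor_sum_def dual_scale algebra_simps)
  show "dual_tensor_sum xs v (w + w') = dual_tensor_sum xs v w + dual_tensor_sum xs v w'"
    using xs by (induction xs) (auto simp: dual_tensor_sum_def dual_add algebra_simps)
  show "dual_tensor_sum xs v (s2 c w) = c * dual_tensor_sum xs v w"
    using xs by (induction xs) (auto simp: dual_tensor_sum_def dual_scale algebra_simps)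
qed

text \<open>The factors \<open>f\<close> and \<open>g\<close> have to be non-zero, since the pair is
  to be a point of the product. In \<open>a \<otimes> b + c \<otimes> d\<close> they are
  \<open>c\<close> and \<open>b\<close>. If one of these vanishes, a single pure tensor remains; its
  two factors are non-zero because \<phi> is, and they serve as \<open>f\<close> and
  \<open>g\<close> with \<open>h\<^sub>2 = 0\<close>.\<close>

lemma tensor_rank_le2_cases:
  assumes "\<phi> \<in> dual_tensor_space s1 s2" "\<phi> \<noteq> 0" "tensor_rank s1 s2 \<phi> \<le> 2"
  obtains f g h\<^sub>1 h\<^sub>2 where "f \<in> dual s1 - {0}" "g \<in> dual s2 - {0}" "h\<^sub>1 \<in> dual s1" "h\<^sub>2 \<in> dual s2"
    "\<phi> = dual_tensor_sum [(h\<^sub>1, g), (f, h\<^sub>2)]"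
proof -
  let ?P = "\<lambda>r. \<exists>xs. length xs = r \<and> set xs \<subseteq> dual s1 \<times> dual s2 \<and> \<phi> = dual_tensor_sum xs"
  have "\<exists>r. ?P r" using assms(1) by (auto simp: dual_tensor_space_def)
  then have "?P (tensor_rank s1 s2 \<phi>)" unfolding tensor_rank_def by (rule LeastI_ex)
  with assms(3) obtain xs where xs: "length xs \<le> 2" "set xs \<subseteq> dual s1 \<times> dual s2"
    "\<phi> = dual_tensor_sum xs"
    by metis
  have zero: "0 \<in> dual s2" by (rule vs2.dualI) auto
  note found = that
  have one: thesis if "\<phi> = dual_tensor_sum [(a, b)]" "a \<in> dual s1" "b \<in> dual s2" for a b
  proof (rule found[of a b a 0])
    show "a \<in> dual s1 - {0}" "b \<in> dual s2 - {0}"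
      using that assms(2) by (auto simp: dual_tensor_sum_def fun_eq_iff)
  qed (use zero that in \<open>auto simp: dual_tensor_sum_def fun_eq_iff\<close>)
  consider "xs = []" | a b where "xs = [(a, b)]" | a b c d where "xs = [(a, b), (c, d)]"
    using xs(1) by (auto simp: le_Suc_eq numeral_2_eq_2 length_Suc_conv)
  then show thesis
  proof cases
    case 1
    with xs assms(2) show ?thesis by (auto simp: dual_tensor_sum_def fun_eq_iff)
  next
    case (2 a b)
    with xs one show ?thesis by auto
  next
    case (3 a b c d)
    consider "b = 0" | "c = 0" | "b \<noteq> 0" "c \<noteq> 0" by auto
    then show ?thesis
    proof cases
      case 1
      with 3 xs show ?thesis by (intro one[of c d]) (auto simp: dual_tensor_sum_def fun_eq_iff)
    next
      case 2
      with 3 xs show ?thesis by (intro one[of a b]) (auto simp: dual_tensor_sum_def fun_eq_iff)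
    next
      case nz: 3
      with 3 xs show ?thesis by (intro found[of c b a d]) auto
    qed
  qed
qed

end

section \<open>Local exactness\<close>

lemma cone_mono: "V \<subseteq> U \<Longrightarrow> cone s1 s2 V \<subseteq> cone s1 s2 U"
  by (auto simp: cone_def)

lemma on_cone_on_cone: "V \<subseteq> U \<Longrightarrow> on_cone s1 s2 V (on_cone s1 s2 U h) = on_cone s1 s2 V h"
  using cone_mono[of V U s1 s2] by (auto simp: on_cone_def fun_eq_iff)

lemma twist_sectionsI:
  assumes "openin (zariski s1 s2) W" "F \<in> bihom (a + c) (b + d)" "G \<in> bihom c d"
    and "\<And>f g. (f, g) \<in> cone s1 s2 W \<Longrightarrow> G f g \<noteq> 0 \<and> h f g = F f g / G f g"
  shows "on_cone s1 s2 W h \<in> twist_sections s1 s2 a b W"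
  unfolding twist_sections_def
proof (intro CollectI conjI ballI)
  show "on_cone s1 s2 W (on_cone s1 s2 W h) = on_cone s1 s2 W h" by (simp add: on_cone_on_cone)
  fix x assume x: "x \<in> W"
  have "\<forall>(f, g)\<in>cone s1 s2 W. G f g \<noteq> 0 \<and> on_cone s1 s2 W h f g = F f g / G f g"
    using assms(4) by (simp add: on_cone_def split_beta)
  with assms x show "\<exists>W' c d. \<exists>F\<in>bihom (a + c) (b + d). \<exists>G\<in>bihom c d.
      openin (zariski s1 s2) W' \<and> x \<in> W' \<and> W' \<subseteq> W \<and>
      (\<forall>(f, g)\<in>cone s1 s2 W'. G f g \<noteq> 0 \<and> on_cone s1 s2 W h f g = F f g / G f g)"
    by blast
qed

locale koszul_point = tensor_pair s1 s2 B1 B2 + cone_point s1 s2 f\<^sub>0 g\<^sub>0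
  for s1 :: "'k::field \<Rightarrow> 'v::ab_group_add \<Rightarrow> 'v" and s2 :: "'k \<Rightarrow> 'w::ab_group_add \<Rightarrow> 'w"
    and B1 B2 f\<^sub>0 g\<^sub>0 +
  fixes K :: "('k, 'v, 'w) tensor set" and e\<^sub>1 :: 'v and e\<^sub>2 :: 'w
  assumes K_tensors: "K \<subseteq> tensor_space s1 s2"
    and e\<^sub>1: "f\<^sub>0 e\<^sub>1 \<noteq> 0" and e\<^sub>2: "g\<^sub>0 e\<^sub>2 \<noteq> 0"
    and annihilator_rank: "\<And>\<phi>. \<phi> \<in> annihilator s1 s2 K \<Longrightarrow> tensor_rank s1 s2 \<phi> \<le> 2 \<Longrightarrow> \<phi> = 0"
begin

text \<open>The fibre maps of \<open>\<alpha>\<close> and \<open>\<beta>\<close> in the trivialisations of the twisting sheaves given by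
  \<open>e\<^sub>1\<close> and \<open>e\<^sub>2\<close>; the vector \<open>(e\<^sub>1, 0)\<close> splits \<open>\<beta>\<close>.\<close>

definition alpha_at :: "('v \<Rightarrow> 'k) \<times> ('w \<Rightarrow> 'k) \<Rightarrow> ('k, 'v, 'w) tensor \<Rightarrow> 'v \<times> 'w" where
  "alpha_at x t =
    (s1 (inverse (snd x e\<^sub>2)) (tensor_lift s1 s2 (\<lambda>v w. s1 (snd x w) v) t),
     - s2 (inverse (fst x e\<^sub>1)) (tensor_lift s1 s2 (\<lambda>v w. s2 (fst x v) w) t))"

definition beta_at :: "('v \<Rightarrow> 'k) \<times> ('w \<Rightarrow> 'k) \<Rightarrow> 'v \<times> 'w \<Rightarrow> 'k" where
  "beta_at x m = inverse (fst x e\<^sub>1) * fst x (fst m) + inverse (snd x e\<^sub>2) * snd x (snd m)"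

text \<open>The values of \<alpha> lie in the kernel of \<beta>, a proper subspace of the fibre. The
  additional vector makes it possible for the values to span everything, which is what Nakayama's
  lemma for the free module requires.\<close>

definition generators :: "(('v \<Rightarrow> 'k) \<times> ('w \<Rightarrow> 'k) \<Rightarrow> 'v \<times> 'w) set" where
  "generators = insert (\<lambda>_. (e\<^sub>1, 0)) ((\<lambda>t x. alpha_at x t) ` K)"

lemma K_tensor_sum: "t \<in> K \<Longrightarrow> \<exists>xs. t = tensor_sum s1 s2 xs"
  using K_tensors unfolding tensor_space_def by blast

lemma alpha_at_tensor_sum:
  assumes "fst x \<in> dual s1" "snd x \<in> dual s2"
  shows "alpha_at x (tensor_sum s1 s2 xs) =
    (s1 (inverse (snd x e\<^sub>2)) (\<Sum>(v, w)\<leftarrow>xs. s1 (snd x w) v),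
     - s2 (inverse (fst x e\<^sub>1)) (\<Sum>(v, w)\<leftarrow>xs. s2 (fst x v) w))"
  by (simp only: alpha_at_def tensor_lift_tensor_sum[OF bilinear_left[OF assms(2)]]
      tensor_lift_tensor_sum[OF bilinear_right[OF assms(1)]])

lemma eventually_dual:
  "eventually (\<lambda>x. fst x \<in> dual s1 \<and> snd x \<in> dual s2 \<and> fst x e\<^sub>1 \<noteq> 0 \<and> snd x e\<^sub>2 \<noteq> 0) nearby"
proof -
  have "eventually (\<lambda>x. fst x \<in> dual s1 \<and> snd x \<in> dual s2) nearby"
    using mem_topspace by (auto simp: eventually_nearby mem_cone)
  then show ?thesis
    using eventually_bihom_nonzero[OF bihom_eval_left[of e\<^sub>1]] e\<^sub>1
      eventually_bihom_nonzero[OF bihom_eval_right[of e\<^sub>2]] e\<^sub>2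
    by (simp add: eventually_conj_iff)
qed

lemma regular_left: "(\<lambda>x. inverse (fst x e\<^sub>1) * fst x v) \<in> regular_at s1 s2 (f\<^sub>0, g\<^sub>0)"
  by (rule regularI[OF bihom_eval_left[of v] bihom_eval_left[of e\<^sub>1]])
    (use e\<^sub>1 in \<open>auto simp: field_simps\<close>)

lemma regular_right: "(\<lambda>x. inverse (snd x e\<^sub>2) * snd x w) \<in> regular_at s1 s2 (f\<^sub>0, g\<^sub>0)"
  by (rule regularI[OF bihom_eval_right[of w] bihom_eval_right[of e\<^sub>2]])
    (use e\<^sub>2 in \<open>auto simp: field_simps\<close>)

abbreviation "regular_vectors \<equiv> combinations scale (range (\<lambda>e _. e))"

lemma regular_vectors_scale_const:
  assumes "r \<in> regular_at s1 s2 (f\<^sub>0, g\<^sub>0)"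
  shows "(\<lambda>x. scale (r x) e) \<in> regular_vectors"
  by (rule combinations_scale[OF p.vector_space_axioms assms
        combinations_base[OF p.vector_space_axioms]]) auto

text \<open>For a tensor given as a sum of \<open>v \<otimes> w\<close>, the trivialised \<alpha> is
  the sum of the constant vectors \<open>(v, 0)\<close> and \<open>(0, - w)\<close> with
  coefficients \<open>g(w) / g(e\<^sub>2)\<close> and \<open>f(v) / f(e\<^sub>1)\<close>, quotients
  of linear forms.\<close>

lemma generators_regular: "generators \<subseteq> regular_vectors"
proof -
  have "(\<lambda>x. alpha_at x t) \<in> regular_vectors" if "t \<in> K" for t
  proof -
    obtain xs where t: "t = tensor_sum s1 s2 xs" using K_tensor_sum[OF \<open>t \<in> K\<close>] by blast
    have "(\<lambda>x. \<Sum>(v, w)\<leftarrow>xs. scale (inverse (snd x e\<^sub>2) * snd x w) (v, 0) +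
        scale (inverse (fst x e\<^sub>1) * fst x v) (0, - w)) \<in> regular_vectors"
    proof (induction xs)
      case (Cons y xs)
      then show ?case
        by (cases y) (simp add: combinations_add regular_vectors_scale_const regular_left regular_right)
    qed (simp add: combinations_zero)
    moreover have "eventually (\<lambda>x. alpha_at x t =
       (\<Sum>(v, w)\<leftarrow>xs. scale (inverse (snd x e\<^sub>2) * snd x w) (v, 0) +
        scale (inverse (fst x e\<^sub>1) * fst x v) (0, - w))) nearby"
      using eventually_dual
    proof eventually_elim
      case (elim x)
      have "(s1 (inverse (snd x e\<^sub>2)) (\<Sum>(v, w)\<leftarrow>xs. s1 (snd x w) v),
         - s2 (inverse (fst x e\<^sub>1)) (\<Sum>(v, w)\<leftarrow>xs. s2 (fst x v) w)) =
        (\<Sum>(v, w)\<leftarrow>xs. scale (inverse (snd x e\<^sub>2) * snd x w) (v, 0) +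
          scale (inverse (fst x e\<^sub>1) * fst x v) (0, - w))"
      proof (induction xs)
        case (Cons y xs)
        obtain v w where y: "y = (v, w)" by (cases y)
        show ?case
          unfolding y list.map sum_list.Cons prod.case Cons[symmetric]
          by (simp add: scale_prod vs1.scale_right_distrib vs2.scale_right_distrib)
      qed (simp add: zero_prod_def)
      then show ?case using elim by (simp add: t alpha_at_tensor_sum)
    qed
    ultimately show ?thesis by (rule combinations_cong)
  qed
  moreover have "(\<lambda>_. (e\<^sub>1, 0)) \<in> regular_vectors"
    by (rule combinations_base[OF p.vector_space_axioms]) auto
  ultimately show ?thesis by (auto simp: generators_def)
qed

text \<open>This is where the rank condition enters. A functional that kills all the values yields a
  tensor of rank at most two in the annihilator of \<open>K\<close>, hence zero; killing the
  additional generator as well, the functional itself vanishes.\<close>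

lemma generators_span: "p.span ((\<lambda>u. u (f\<^sub>0, g\<^sub>0)) ` generators) = UNIV"
proof (rule ccontr)
  assume "p.span ((\<lambda>u. u (f\<^sub>0, g\<^sub>0)) ` generators) \<noteq> UNIV"
  then obtain y where "y \<notin> p.span ((\<lambda>u. u (f\<^sub>0, g\<^sub>0)) ` generators)" by auto
  from p.separating_functional[OF this] obtain h where h: "h \<in> dual scale" "h y = 1"
    and h_gen: "\<And>u. u \<in> generators \<Longrightarrow> h (u (f\<^sub>0, g\<^sub>0)) = 0" by auto
  have f0: "f\<^sub>0 \<in> dual s1" and g0: "g\<^sub>0 \<in> dual s2" using f\<^sub>0 g\<^sub>0 by auto
  \<comment> \<open>The inverse factors match the trivialisations in \<open>alpha_at\<close>, and
    the sign of \<open>h\<^sub>2\<close> absorbs the sign of \<alpha>. Hence \<open>h\<close>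
    applied to \<open>alpha_at\<close> of a tensor is the value of \<open>h\<^sub>1 \<otimes>
    g\<^sub>0 + f\<^sub>0 \<otimes> h\<^sub>2\<close> on it.\<close>
  define h\<^sub>1 where "h\<^sub>1 v = inverse (g\<^sub>0 e\<^sub>2) * h (v, 0)" for v
  define h\<^sub>2 where "h\<^sub>2 w = - inverse (f\<^sub>0 e\<^sub>1) * h (0, w)" for w
  have h_add: "h (v + v', w + w') = h (v, w) + h (v', w')" for v v' w w'
    using dual_add[OF h(1), of "(v, w)" "(v', w')"] by simp
  have h_scale: "h (s1 c v, s2 c w) = c * h (v, w)" for c v w
    using dual_scale[OF h(1), of c "(v, w)"] by (simp add: scale_prod)
  have h_split: "h (v, w) = h (v, 0) + h (0, w)" for v w using h_add[of v 0 0 w] by simp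
  have h1: "h\<^sub>1 \<in> dual s1"
    using h_add[of _ _ 0 0] h_scale[of _ _ 0]
    by (intro vs1.dualI) (auto simp: h\<^sub>1_def algebra_simps)
  have h2: "h\<^sub>2 \<in> dual s2"
    using h_add[of 0 0] h_scale[of _ 0]
    by (intro vs2.dualI) (auto simp: h\<^sub>2_def algebra_simps)
  define xs where "xs = [(h\<^sub>1, g\<^sub>0), (f\<^sub>0, h\<^sub>2)]"
  have xs: "set xs \<subseteq> dual s1 \<times> dual s2" using f0 g0 h1 h2 by (auto simp: xs_def)
  have "dual_tensor_sum xs \<in> annihilator s1 s2 K"
  proof -
    have "tensor_lift s1 s2 (dual_tensor_sum xs) t = 0" if "t \<in> K" for t
    proof -
      obtain ys where t: "t = tensor_sum s1 s2 ys" using K_tensor_sum[OF \<open>t \<in> K\<close>] by blast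
      have "h (alpha_at (f\<^sub>0, g\<^sub>0) t) = 0"
        using h_gen[of "\<lambda>x. alpha_at x t"] that by (auto simp: generators_def)
      also have "alpha_at (f\<^sub>0, g\<^sub>0) t = (s1 (inverse (g\<^sub>0 e\<^sub>2)) (\<Sum>(v, w)\<leftarrow>ys. s1 (g\<^sub>0 w) v),
         - s2 (inverse (f\<^sub>0 e\<^sub>1)) (\<Sum>(v, w)\<leftarrow>ys. s2 (f\<^sub>0 v) w))"
        using f0 g0 by (simp add: t alpha_at_tensor_sum)
      also have "h \<dots> = h\<^sub>1 (\<Sum>(v, w)\<leftarrow>ys. s1 (g\<^sub>0 w) v) + h\<^sub>2 (\<Sum>(v, w)\<leftarrow>ys. s2 (f\<^sub>0 v) w)"
        using h_scale[of "inverse (g\<^sub>0 e\<^sub>2)" _ 0] h_scale[of "- inverse (f\<^sub>0 e\<^sub>1)" 0]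
        by (subst h_split) (simp add: h\<^sub>1_def h\<^sub>2_def)
      also have "\<dots> = (\<Sum>(v, w)\<leftarrow>ys. dual_tensor_sum xs v w)"
        by (induction ys) (auto simp: xs_def dual_tensor_sum_def dual_add[OF h1] dual_add[OF h2]
            dual_scale[OF h1] dual_scale[OF h2] dual_zero[OF h1] dual_zero[OF h2])
      finally show ?thesis
        by (simp add: t tensor_lift_tensor_sum[OF bilinear_dual_tensor_sum[OF xs]])
    qed
    then show ?thesis using xs by (auto simp: annihilator_def dual_tensor_space_def)
  qed
  moreover have "tensor_rank s1 s2 (dual_tensor_sum xs) \<le> 2"
    unfolding tensor_rank_def by (rule Least_le) (use xs in \<open>auto simp: xs_def intro!: exI[of _ xs]\<close>)
  ultimately have "dual_tensor_sum xs = 0" by (rule annihilator_rank)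
  then have phi: "h\<^sub>1 v * g\<^sub>0 w + f\<^sub>0 v * h\<^sub>2 w = 0" for v w
    by (auto simp: dual_tensor_sum_def xs_def fun_eq_iff)
  \<comment> \<open>The vanishing of the tensor alone would still allow \<open>h\<^sub>1\<close> and
    \<open>h\<^sub>2\<close> to be the multiples of \<open>f\<^sub>0\<close> and
    \<open>- g\<^sub>0\<close> by one common scalar. The value at \<open>e\<^sub>1\<close>, where
    \<open>f\<^sub>0\<close> is non-zero, shows that this scalar is 0.\<close>
  have "h\<^sub>1 e\<^sub>1 = 0" using h_gen[of "\<lambda>_. (e\<^sub>1, 0)"] by (simp add: h\<^sub>1_def generators_def)
  then have "h\<^sub>2 w = 0" for w using phi[of e\<^sub>1 w] e\<^sub>1 by simp
  moreover from this have "h\<^sub>1 v = 0" for v using phi[of v e\<^sub>2] e\<^sub>2 by simp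
  ultimately have "h (v, w) = 0" for v w
    using e\<^sub>1 e\<^sub>2 by (subst h_split) (simp add: h\<^sub>1_def h\<^sub>2_def)
  then show False using h(2) by (cases y) simp
qed

lemma beta_at_alpha_at:
  assumes "t \<in> K" "fst x \<in> dual s1" "snd x \<in> dual s2"
  shows "beta_at x (alpha_at x t) = 0"
proof -
  obtain xs where t: "t = tensor_sum s1 s2 xs" using assms K_tensor_sum by blast
  have "fst x (\<Sum>(v, w)\<leftarrow>xs. s1 (snd x w) v) = snd x (\<Sum>(v, w)\<leftarrow>xs. s2 (fst x v) w)"
    by (induction xs) (auto simp: dual_zero[OF assms(2)] dual_zero[OF assms(3)]
        dual_add[OF assms(2)] dual_add[OF assms(3)] dual_scale[OF assms(2)] dual_scale[OF assms(3)])
  then show ?thesis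
    by (simp add: t alpha_at_tensor_sum[OF assms(2,3)] beta_at_def dual_minus[OF assms(3)]
        dual_scale[OF assms(2)] dual_scale[OF assms(3)])
qed

lemma beta_at_add: "fst x \<in> dual s1 \<Longrightarrow> snd x \<in> dual s2 \<Longrightarrow>
    beta_at x (m + n) = beta_at x m + beta_at x n"
  and beta_at_scale: "fst x \<in> dual s1 \<Longrightarrow> snd x \<in> dual s2 \<Longrightarrow>
    beta_at x (scale c m) = c * beta_at x m"
  by (auto simp: beta_at_def dual_add dual_scale scale_def algebra_simps)

text \<open>Nakayama's lemma writes \<open>m\<close> through the values of \<alpha> and a multiple
  of \<open>(e\<^sub>1, 0)\<close>. Applying \<beta> kills \<open>m\<close> and the values of
  \<alpha>, while \<open>(e\<^sub>1, 0)\<close> has \<beta>-value 1; so its coefficient vanishes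
  near the point.\<close>

lemma kernel_lift:
  assumes m: "m \<in> regular_vectors" and beta: "eventually (\<lambda>x. beta_at x (m x) = 0) nearby"
  shows "\<exists>ts. set ts \<subseteq> K \<times> regular_at s1 s2 (f\<^sub>0, g\<^sub>0) \<and>
    eventually (\<lambda>x. m x = (\<Sum>(t, r)\<leftarrow>ts. scale (r x) (alpha_at x t))) nearby"
proof -
  have "m \<in> combinations scale generators"
    using nakayama[OF p.vector_space_axioms p.finite_Basis p.span_Basis generators_regular
        generators_span] m by auto
  then obtain xs where xs: "set xs \<subseteq> generators \<times> regular_at s1 s2 (f\<^sub>0, g\<^sub>0)"
    and ev: "eventually (\<lambda>x. m x = (\<Sum>(u, r)\<leftarrow>xs. scale (r x) (u x))) nearby"
    by (auto simp: combinations_def)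
  \<comment> \<open>All occurrences of \<open>(e\<^sub>1, 0)\<close> are collected into a single
    coefficient \<open>r\<close>.\<close>
  from xs have "\<exists>ts r. set ts \<subseteq> K \<times> regular_at s1 s2 (f\<^sub>0, g\<^sub>0) \<and>
    (\<forall>x. (\<Sum>(u, r)\<leftarrow>xs. scale (r x) (u x)) =
      (\<Sum>(t, r)\<leftarrow>ts. scale (r x) (alpha_at x t)) + scale (r x) (e\<^sub>1, 0))"
  proof (induction xs)
    case Nil
    show ?case by (rule exI[of _ "[]"], rule exI[of _ "\<lambda>_. 0"]) simp
  next
    case (Cons y xs)
    obtain u \<rho> where y: "y = (u, \<rho>)" by (cases y)
    from Cons obtain ts r where ts: "set ts \<subseteq> K \<times> regular_at s1 s2 (f\<^sub>0, g\<^sub>0)"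
      and eq: "\<And>x. (\<Sum>(u, r)\<leftarrow>xs. scale (r x) (u x)) =
      (\<Sum>(t, r)\<leftarrow>ts. scale (r x) (alpha_at x t)) + scale (r x) (e\<^sub>1, 0)" by auto
    from Cons.prems consider "u = (\<lambda>_. (e\<^sub>1, 0))" | t where "t \<in> K" "u = (\<lambda>x. alpha_at x t)"
      by (auto simp: y generators_def)
    then show ?case
    proof cases
      case 1
      with ts show ?thesis
        by (intro exI[of _ ts] exI[of _ "\<lambda>x. \<rho> x + r x"])
          (simp add: y eq p.scale_left_distrib)
    next
      case 2
      with ts Cons.prems show ?thesis
        by (intro exI[of _ "(t, \<rho>) # ts"] exI[of _ r]) (simp add: y eq add.assoc)
    qed
  qed
  then obtain ts r where ts: "set ts \<subseteq> K \<times> regular_at s1 s2 (f\<^sub>0, g\<^sub>0)"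
      and eq: "\<And>x. (\<Sum>(u, r)\<leftarrow>xs. scale (r x) (u x)) =
      (\<Sum>(t, r)\<leftarrow>ts. scale (r x) (alpha_at x t)) + scale (r x) (e\<^sub>1, 0)" by auto
  have "eventually (\<lambda>x. m x = (\<Sum>(t, r)\<leftarrow>ts. scale (r x) (alpha_at x t))) nearby"
    using ev eventually_dual beta
  proof eventually_elim
    case (elim x)
    then have x: "fst x \<in> dual s1" "snd x \<in> dual s2" "fst x e\<^sub>1 \<noteq> 0" by auto
    have "beta_at x (\<Sum>(t, r)\<leftarrow>ts. scale (r x) (alpha_at x t)) = 0"
      using ts
    proof (induction ts)
      case Nil
      show ?case by (simp add: beta_at_def dual_zero[OF x(1)] dual_zero[OF x(2)])
    next
      case (Cons y ts)
      then show ?case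
        using x by (auto simp: beta_at_add beta_at_scale beta_at_alpha_at)
    qed
    moreover have "beta_at x (e\<^sub>1, 0) = 1"
      using x by (simp add: beta_at_def dual_zero[OF x(2)])
    ultimately have "r x = 0"
      using elim by (simp add: eq beta_at_add beta_at_scale)
    then show ?case using elim by (simp add: eq)
  qed
  with ts show ?thesis by blast
qed

section \<open>Passage between sections of the twisting sheaves and regular functions at the
  point\<close>

lemma twist_section_quotient:
  assumes "\<sigma> \<in> twist_sections s1 s2 a b U" "(proj_point f\<^sub>0, proj_point g\<^sub>0) \<in> U"
  obtains c d F G where "F \<in> bihom (a + c) (b + d)" "G \<in> bihom c d" "G f\<^sub>0 g\<^sub>0 \<noteq> 0"
    "eventually (\<lambda>x. \<sigma> (fst x) (snd x) = F (fst x) (snd x) / G (fst x) (snd x)) nearby"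
proof -
  from assms obtain W c d F G where FG: "F \<in> bihom (a + c) (b + d)" "G \<in> bihom c d"
    and W: "openin (zariski s1 s2) W" "(proj_point f\<^sub>0, proj_point g\<^sub>0) \<in> W"
    "\<forall>(f, g)\<in>cone s1 s2 W. G f g \<noteq> 0 \<and> \<sigma> f g = F f g / G f g"
    unfolding twist_sections_def by blast
  have "eventually (\<lambda>x. G (fst x) (snd x) \<noteq> 0 \<and>
      \<sigma> (fst x) (snd x) = F (fst x) (snd x) / G (fst x) (snd x)) nearby"
    unfolding eventually_nearby using W by (intro exI[of _ W]) auto
  moreover from eventually_nearby_at[OF this] have "G f\<^sub>0 g\<^sub>0 \<noteq> 0" by simp
  ultimately show ?thesis by (intro that[OF FG]) (auto elim!: eventually_mono)
qed

text \<open>Multiplying the denominator by the linear form \<open>f(e\<^sub>1)\<close>, non-zero at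
  the point, turns a quotient of bidegree (1, 0) into one of bidegree (0, 0).\<close>

lemma regular_twist_left:
  assumes "\<sigma> \<in> twist_sections s1 s2 1 0 U" "(proj_point f\<^sub>0, proj_point g\<^sub>0) \<in> U"
  shows "(\<lambda>x. inverse (fst x e\<^sub>1) * \<sigma> (fst x) (snd x)) \<in> regular_at s1 s2 (f\<^sub>0, g\<^sub>0)"
proof -
  obtain c d F G where FG: "F \<in> bihom (1 + c) (0 + d)" "G \<in> bihom c d" "G f\<^sub>0 g\<^sub>0 \<noteq> 0"
    "eventually (\<lambda>x. \<sigma> (fst x) (snd x) = F (fst x) (snd x) / G (fst x) (snd x)) nearby"
    by (rule twist_section_quotient[OF assms])
  show ?thesis
    by (rule regularI[OF FG(1) bihom_mult[OF bihom_eval_left[of e\<^sub>1] FG(2)]])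
      (use FG(3,4) e\<^sub>1 in \<open>auto elim!: eventually_mono simp: field_simps\<close>)
qed

lemma regular_twist_right:
  assumes "\<sigma> \<in> twist_sections s1 s2 0 1 U" "(proj_point f\<^sub>0, proj_point g\<^sub>0) \<in> U"
  shows "(\<lambda>x. inverse (snd x e\<^sub>2) * \<sigma> (fst x) (snd x)) \<in> regular_at s1 s2 (f\<^sub>0, g\<^sub>0)"
proof -
  obtain c d F G where FG: "F \<in> bihom (0 + c) (1 + d)" "G \<in> bihom c d" "G f\<^sub>0 g\<^sub>0 \<noteq> 0"
    "eventually (\<lambda>x. \<sigma> (fst x) (snd x) = F (fst x) (snd x) / G (fst x) (snd x)) nearby"
    by (rule twist_section_quotient[OF assms])
  show ?thesis
    by (rule regularI[OF FG(1) bihom_mult[OF bihom_eval_right[of e\<^sub>2] FG(2)]])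
      (use FG(3,4) e\<^sub>2 in \<open>auto elim!: eventually_mono simp: field_simps\<close>)
qed

text \<open>The coefficients of a lift have to be sections over one open set. Each is a quotient on
  a neighbourhood of its own, and finitely many neighbourhoods are intersected.\<close>

lemma regular_common_nhd:
  assumes "set rs \<subseteq> regular_at s1 s2 (f\<^sub>0, g\<^sub>0)"
  shows "\<exists>W. openin (zariski s1 s2) W \<and> (proj_point f\<^sub>0, proj_point g\<^sub>0) \<in> W \<and>
    (\<forall>r\<in>set rs. \<exists>c d. \<exists>F\<in>bihom c d. \<exists>G\<in>bihom c d.
       \<forall>x\<in>cone s1 s2 W. G (fst x) (snd x) \<noteq> 0 \<and> r x = F (fst x) (snd x) / G (fst x) (snd x))"
  using assms
proof (induction rs)
  case Nil
  show ?case using mem_topspace by (intro exI[of _ "topspace (zariski s1 s2)"]) auto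
next
  case (Cons r rs)
  then obtain W where W: "openin (zariski s1 s2) W" "(proj_point f\<^sub>0, proj_point g\<^sub>0) \<in> W"
    and rs: "\<forall>r\<in>set rs. \<exists>c d. \<exists>F\<in>bihom c d. \<exists>G\<in>bihom c d.
       \<forall>x\<in>cone s1 s2 W. G (fst x) (snd x) \<noteq> 0 \<and> r x = F (fst x) (snd x) / G (fst x) (snd x)"
    by auto
  from Cons.prems have "r \<in> regular_at s1 s2 (f\<^sub>0, g\<^sub>0)" by simp
  then obtain c d F G where FG: "F \<in> bihom c d" "G \<in> bihom c d" and
    "eventually (\<lambda>x. G (fst x) (snd x) \<noteq> 0 \<and> r x = F (fst x) (snd x) / G (fst x) (snd x)) nearby"
    by (elim regularE)
  then obtain W' where W': "openin (zariski s1 s2) W'" "(proj_point f\<^sub>0, proj_point g\<^sub>0) \<in> W'"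
    and r: "\<forall>x\<in>cone s1 s2 W'. G (fst x) (snd x) \<noteq> 0 \<and> r x = F (fst x) (snd x) / G (fst x) (snd x)"
    by (auto simp: eventually_nearby)
  have sub: "cone s1 s2 (W \<inter> W') \<subseteq> cone s1 s2 W" "cone s1 s2 (W \<inter> W') \<subseteq> cone s1 s2 W'"
    by (auto simp: mem_cone)
  show ?case
  proof (intro exI[of _ "W \<inter> W'"] conjI ballI)
    fix r' assume "r' \<in> set (r # rs)"
    then consider "r' = r" | "r' \<in> set rs" by auto
    then show "\<exists>c d. \<exists>F\<in>bihom c d. \<exists>G\<in>bihom c d. \<forall>x\<in>cone s1 s2 (W \<inter> W').
        G (fst x) (snd x) \<noteq> 0 \<and> r' x = F (fst x) (snd x) / G (fst x) (snd x)"
    proof cases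
      case 1
      with FG r sub(2) show ?thesis by blast
    next
      case 2
      with rs sub(1) show ?thesis by (meson subsetD)
    qed
  qed (use W W' in auto)
qed

text \<open>The cycle \<open>(P, Q)\<close> is trivialised to a regular vector function in the
  kernel of \<beta> and lifted there. On a common neighbourhood the coefficients of the lift are
  sections of the structure sheaf, so they define a section of \<open>K \<otimes> \<O>\<close>; the
  trivialising factors cancel in its image under \<alpha>.\<close>

lemma local_lift:
  assumes U: "openin (zariski s1 s2) U" "(proj_point f\<^sub>0, proj_point g\<^sub>0) \<in> U"
    and P: "P \<in> carrier (sections (twist_sheaf s1 s2 s1 UNIV 0 1) U)"
    and Q: "Q \<in> carrier (sections (twist_sheaf s1 s2 s2 UNIV 1 0) U)"
    and ker: "\<And>f g. (f, g) \<in> cone s1 s2 U \<Longrightarrow> f (P f g) + g (Q f g) = 0"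
  obtains W A where "openin (zariski s1 s2) W" "(proj_point f\<^sub>0, proj_point g\<^sub>0) \<in> W" "W \<subseteq> U"
    "A \<in> carrier (sections (twist_sheaf s1 s2 tensor_scale K 0 0) W)"
    "koszul_alpha s1 s2 W A = (on_cone s1 s2 W P, on_cone s1 s2 W Q)"
proof -
  define m where "m = (\<lambda>x. (s1 (inverse (snd x e\<^sub>2)) (P (fst x) (snd x)),
    s2 (inverse (fst x e\<^sub>1)) (Q (fst x) (snd x))))"
  have "m \<in> regular_vectors"
  proof -
    from P obtain xs where xs: "set xs \<subseteq> UNIV \<times> twist_sections s1 s2 0 1 U"
      and P_eq: "P = (\<lambda>f g. \<Sum>(e, \<sigma>)\<leftarrow>xs. s1 (\<sigma> f g) e)" by (auto simp: twist_sheaf_def)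
    from Q obtain ys where ys: "set ys \<subseteq> UNIV \<times> twist_sections s1 s2 1 0 U"
      and Q_eq: "Q = (\<lambda>f g. \<Sum>(e, \<sigma>)\<leftarrow>ys. s2 (\<sigma> f g) e)" by (auto simp: twist_sheaf_def)
    from xs have "(\<lambda>x. (s1 (inverse (snd x e\<^sub>2)) (\<Sum>(e, \<sigma>)\<leftarrow>xs. s1 (\<sigma> (fst x) (snd x)) e), 0))
        \<in> regular_vectors"
    proof (induction xs)
      case Nil
      show ?case using combinations_zero[of scale] by (simp add: zero_prod_def)
    next
      case (Cons y xs)
      obtain e \<sigma> where y: "y = (e, \<sigma>)" by (cases y)
      have "(\<lambda>x. scale (inverse (snd x e\<^sub>2) * \<sigma> (fst x) (snd x)) (e, 0)) \<in> regular_vectors"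
        using Cons.prems U(2) by (intro regular_vectors_scale_const regular_twist_right) (auto simp: y)
      from combinations_add[OF this Cons.IH] Cons.prems show ?case
        by (simp add: y scale_prod vs1.scale_right_distrib)
    qed
    moreover from ys have "(\<lambda>x. (0, s2 (inverse (fst x e\<^sub>1)) (\<Sum>(e, \<sigma>)\<leftarrow>ys. s2 (\<sigma> (fst x) (snd x)) e)))
        \<in> regular_vectors"
    proof (induction ys)
      case Nil
      show ?case using combinations_zero[of scale] by (simp add: zero_prod_def)
    next
      case (Cons y ys)
      obtain e \<sigma> where y: "y = (e, \<sigma>)" by (cases y)
      have "(\<lambda>x. scale (inverse (fst x e\<^sub>1) * \<sigma> (fst x) (snd x)) (0, e)) \<in> regular_vectors"
        using Cons.prems U(2) by (intro regular_vectors_scale_const regular_twist_left) (auto simp: y)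
      from combinations_add[OF this Cons.IH] Cons.prems show ?case
        by (simp add: y scale_prod vs2.scale_right_distrib)
    qed
    ultimately have "(\<lambda>x. (s1 (inverse (snd x e\<^sub>2)) (P (fst x) (snd x)), 0) +
        (0, s2 (inverse (fst x e\<^sub>1)) (Q (fst x) (snd x)))) \<in> regular_vectors"
      unfolding P_eq Q_eq by (rule combinations_add)
    then show ?thesis by (simp add: m_def)
  qed
  moreover have "eventually (\<lambda>x. beta_at x (m x) = 0) nearby"
  proof -
    have "eventually (\<lambda>x. fst x (P (fst x) (snd x)) + snd x (Q (fst x) (snd x)) = 0) nearby"
      unfolding eventually_nearby using U ker by (intro exI[of _ U]) auto
    with eventually_dual show ?thesis
    proof eventually_elim
      case (elim x)
      \<comment> \<open>The first component of \<open>m\<close> is divided by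
        \<open>g(e\<^sub>2)\<close> and the second by \<open>f(e\<^sub>1)\<close>;
        \<open>beta_at\<close> supplies the other factor in each term, so both terms share the
        denominator \<open>f(e\<^sub>1) g(e\<^sub>2)\<close>.\<close>
      from elim(1) have "beta_at x (m x) = inverse (fst x e\<^sub>1) * inverse (snd x e\<^sub>2) *
          (fst x (P (fst x) (snd x)) + snd x (Q (fst x) (snd x)))"
        by (simp add: beta_at_def m_def dual_scale distrib_left mult.left_commute)
      with elim(2) show ?case by simp
    qed
  qed
  ultimately obtain ts where ts: "set ts \<subseteq> K \<times> regular_at s1 s2 (f\<^sub>0, g\<^sub>0)"
    and "eventually (\<lambda>x. m x = (\<Sum>(t, r)\<leftarrow>ts. scale (r x) (alpha_at x t))) nearby"
    using kernel_lift by blast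
  from eventually_conj[OF this(2) eventually_dual] obtain W\<^sub>1 where
    W1: "openin (zariski s1 s2) W\<^sub>1" "(proj_point f\<^sub>0, proj_point g\<^sub>0) \<in> W\<^sub>1" and
    m: "\<And>x. x \<in> cone s1 s2 W\<^sub>1 \<Longrightarrow> m x = (\<Sum>(t, r)\<leftarrow>ts. scale (r x) (alpha_at x t)) \<and>
      fst x \<in> dual s1 \<and> snd x \<in> dual s2 \<and> fst x e\<^sub>1 \<noteq> 0 \<and> snd x e\<^sub>2 \<noteq> 0"
    unfolding eventually_nearby by blast
  have "set (map snd ts) \<subseteq> regular_at s1 s2 (f\<^sub>0, g\<^sub>0)" using ts by auto
  from regular_common_nhd[OF this] obtain W\<^sub>2 where
    W2: "openin (zariski s1 s2) W\<^sub>2" "(proj_point f\<^sub>0, proj_point g\<^sub>0) \<in> W\<^sub>2" and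
    quotient: "\<forall>r\<in>set (map snd ts). \<exists>c d. \<exists>F\<in>bihom c d. \<exists>G\<in>bihom c d.
       \<forall>x\<in>cone s1 s2 W\<^sub>2. G (fst x) (snd x) \<noteq> 0 \<and> r x = F (fst x) (snd x) / G (fst x) (snd x)"
    by (elim exE conjE) (rule that)
  \<comment> \<open>The lifting identity holds over the first set, the coefficients are quotients of
    polynomials over the second, and the cycle is given over the third.\<close>
  define W where "W = W\<^sub>1 \<inter> W\<^sub>2 \<inter> U"
  have W: "openin (zariski s1 s2) W" "(proj_point f\<^sub>0, proj_point g\<^sub>0) \<in> W" "W \<subseteq> U"
    using W1 W2 U by (auto simp: W_def)
  have W_cone: "x \<in> cone s1 s2 W\<^sub>1" "x \<in> cone s1 s2 W\<^sub>2" if "x \<in> cone s1 s2 W" for x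
    using that by (auto simp: W_def mem_cone)
  define xs where "xs = map (\<lambda>(t, r). (t, on_cone s1 s2 W (\<lambda>f g. r (f, g)))) ts"
  define A where "A = (\<lambda>f g. \<Sum>(t, \<sigma>)\<leftarrow>xs. tensor_scale (\<sigma> f g) t)"
  have "on_cone s1 s2 W (\<lambda>f g. r (f, g)) \<in> twist_sections s1 s2 0 0 W" if "r \<in> set (map snd ts)" for r
  proof -
    from quotient that obtain c d F G where FG: "F \<in> bihom c d" "G \<in> bihom c d"
      and "\<forall>x\<in>cone s1 s2 W\<^sub>2. G (fst x) (snd x) \<noteq> 0 \<and> r x = F (fst x) (snd x) / G (fst x) (snd x)"
      by blast
    then show ?thesis
      using FG W_cone(2) by (intro twist_sectionsI[OF W(1), of F 0 c 0 d G]) force+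
  qed
  with ts have "set xs \<subseteq> K \<times> twist_sections s1 s2 0 0 W" by (force simp: xs_def)
  then have A: "A \<in> carrier (sections (twist_sheaf s1 s2 tensor_scale K 0 0) W)"
    by (auto simp: twist_sheaf_def A_def)
  have alpha: "tensor_lift s1 s2 (\<lambda>v w. s1 (g w) v) (A f g) = P f g \<and>
      - tensor_lift s1 s2 (\<lambda>v w. s2 (f v) w) (A f g) = Q f g" if fg: "(f, g) \<in> cone s1 s2 W" for f g
  proof -
    have m': "m (f, g) = (\<Sum>(t, r)\<leftarrow>ts. scale (r (f, g)) (alpha_at (f, g) t))"
      and dual: "f \<in> dual s1" "g \<in> dual s2" and nz: "f e\<^sub>1 \<noteq> 0" "g e\<^sub>2 \<noteq> 0"
      using m[OF W_cone(1)[OF fg]] by auto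
    define ys where "ys = map (\<lambda>(t, r). (t, r (f, g))) ts"
    have ys: "set ys \<subseteq> tensor_space s1 s2 \<times> UNIV" using ts K_tensors by (auto simp: ys_def)
    have A_eq: "A f g = (\<Sum>(t, c)\<leftarrow>ys. tensor_scale c t)"
      using fg by (simp add: A_def xs_def ys_def on_cone_def case_prod_unfold comp_def)
    have "m (f, g) = (\<Sum>(t, c)\<leftarrow>ys. scale c (alpha_at (f, g) t))"
      by (simp add: m' ys_def case_prod_unfold comp_def)
    also have "\<dots> =
      (s1 (inverse (g e\<^sub>2)) (\<Sum>(t, c)\<leftarrow>ys. s1 c (tensor_lift s1 s2 (\<lambda>v w. s1 (g w) v) t)),
       - s2 (inverse (f e\<^sub>1)) (\<Sum>(t, c)\<leftarrow>ys. s2 c (tensor_lift s1 s2 (\<lambda>v w. s2 (f v) w) t)))"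
    proof (induction ys)
      case (Cons y ys)
      obtain t c where y: "y = (t, c)" by (cases y)
      show ?case
        unfolding y list.map sum_list.Cons prod.case Cons.IH
        by (simp add: alpha_at_def scale_prod vs1.scale_right_distrib vs2.scale_right_distrib mult.commute)
    qed (simp add: zero_prod_def)
    also have "\<dots> = (s1 (inverse (g e\<^sub>2)) (tensor_lift s1 s2 (\<lambda>v w. s1 (g w) v) (A f g)),
       s2 (inverse (f e\<^sub>1)) (- tensor_lift s1 s2 (\<lambda>v w. s2 (f v) w) (A f g)))"
      unfolding A_eq tensor_lift_combination[OF bilinear_left[OF dual(2)] ys]
        tensor_lift_combination[OF bilinear_right[OF dual(1)] ys] by simp
    finally show ?thesis using nz by (simp add: m_def del: vs2.scale_minus_right)
  qed
  have "koszul_alpha s1 s2 W A = (on_cone s1 s2 W P, on_cone s1 s2 W Q)"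
    using alpha by (auto simp: koszul_alpha_def on_cone_def fun_eq_iff)
  with W A show ?thesis by (rule that)
qed

end

section \<open>Vanishing of a sheafification\<close>

text \<open>The presheaf laws on which germs and the neutral section rest: restriction is transitive
  and preserves the neutral section. The vanishing of a sheafification is decided by these
  alone.\<close>

locale zero_presheaf =
  fixes F :: "('x, 's) presheaf"
  assumes restr_restr: "\<And>U V W s. openin (base F) U \<Longrightarrow> openin (base F) V \<Longrightarrow> openin (base F) W \<Longrightarrow>
      W \<subseteq> V \<Longrightarrow> V \<subseteq> U \<Longrightarrow> s \<in> carrier (sections F U) \<Longrightarrow>
      restr F V W (restr F U V s) = restr F U W s"
    and one_closed: "\<And>U. openin (base F) U \<Longrightarrow> \<one>\<^bsub>sections F U\<^esub> \<in> carrier (sections F U)"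
    and restr_one: "\<And>U V. openin (base F) U \<Longrightarrow> openin (base F) V \<Longrightarrow> V \<subseteq> U \<Longrightarrow>
      restr F U V \<one>\<^bsub>sections F U\<^esub> = \<one>\<^bsub>sections F V\<^esub>"
begin

text \<open>Any pair that agrees with \<open>s\<close> on some neighbourhood agrees with
  \<open>t\<close> on its intersection with \<open>W\<close>, by transitivity of
  restriction.\<close>

lemma germ_subset:
  assumes "openin (base F) U" "openin (base F) V" "openin (base F) W" "x \<in> W" "W \<subseteq> U \<inter> V"
    and s: "s \<in> carrier (sections F U)" and t: "t \<in> carrier (sections F V)"
    and eq: "restr F U W s = restr F V W t"
  shows "germ F x U s \<subseteq> germ F x V t"
proof
  fix p assume "p \<in> germ F x U s"
  then obtain V' t' W' where p: "p = (V', t')" "openin (base F) V'" "x \<in> V'"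
      "t' \<in> carrier (sections F V')"
    and W': "openin (base F) W'" "x \<in> W'" "W' \<subseteq> U \<inter> V'" "restr F U W' s = restr F V' W' t'"
    by (auto simp: germ_def)
  have I: "openin (base F) (W \<inter> W')" using assms W' by blast
  have "restr F V (W \<inter> W') t = restr F W (W \<inter> W') (restr F V W t)"
    using assms I by (subst restr_restr) auto
  also have "\<dots> = restr F U (W \<inter> W') s"
    unfolding eq[symmetric] using assms I by (subst restr_restr) auto
  also have "\<dots> = restr F W' (W \<inter> W') (restr F U W' s)"
    using assms I W' by (subst restr_restr) auto
  also have "\<dots> = restr F V' (W \<inter> W') t'"
    unfolding W'(4) using assms I W' p by (subst restr_restr) auto
  finally show "p \<in> germ F x V t"
    using I p W' assms by (auto simp: germ_def intro!: exI[of _ "W \<inter> W'"])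
qed

lemma germ_eq:
  assumes "openin (base F) U" "openin (base F) V" "openin (base F) W" "x \<in> W" "W \<subseteq> U \<inter> V"
    and "s \<in> carrier (sections F U)" "t \<in> carrier (sections F V)"
    and "restr F U W s = restr F V W t"
  shows "germ F x U s = germ F x V t"
  using germ_subset[OF assms] germ_subset[OF assms(2,1,3,4) _ assms(7,6) assms(8)[symmetric]] assms(5)
  by auto

text \<open>A sheafification vanishes exactly when all germs are neutral. A section of the presheaf
  gives a family of germs, hence a section of the sheafification; conversely every section of the
  sheafification is locally such a family.\<close>

lemma zero_sheaf_sheafify_iff:
  "zero_sheaf (sheafify F) \<longleftrightarrow> (\<forall>U s x. openin (base F) U \<longrightarrow> s \<in> carrier (sections F U) \<longrightarrow> x \<in> U \<longrightarrow>
     (\<exists>W. openin (base F) W \<and> x \<in> W \<and> W \<subseteq> U \<and> restr F U W s = \<one>\<^bsub>sections F W\<^esub>))"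
  (is "_ \<longleftrightarrow> ?R")
proof
  assume zero: "zero_sheaf (sheafify F)"
  show ?R
  proof (intro allI impI)
    fix U s x assume U: "openin (base F) U" and s: "s \<in> carrier (sections F U)" and x: "x \<in> U"
    have "(\<lambda>y\<in>U. germ F y U s) \<in> carrier (sections (sheafify F) U)"
      using U s by (auto simp: sheafify_def intro!: exI[of _ U])
    also have "\<dots> = {\<lambda>y\<in>U. germ F y U \<one>\<^bsub>sections F U\<^esub>}"
      using zero U by (simp add: zero_sheaf_def sheafify_def)
    finally have "germ F x U s = germ F x U \<one>\<^bsub>sections F U\<^esub>"
      using x by (auto dest: fun_cong[of _ _ x])
    \<comment> \<open>A germ is a class of pairs, so equality of germs is used by locating the
      neutral section among the representatives of the germ of \<open>s\<close>. Membership unfolds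
      to agreement on a smaller open set.\<close>
    moreover have "(U, \<one>\<^bsub>sections F U\<^esub>) \<in> germ F x U \<one>\<^bsub>sections F U\<^esub>"
      unfolding germ_def using U x one_closed[OF U] by blast
    ultimately have "(U, \<one>\<^bsub>sections F U\<^esub>) \<in> germ F x U s" by simp
    then obtain W where "openin (base F) W" "x \<in> W" "W \<subseteq> U"
        "restr F U W s = restr F U W \<one>\<^bsub>sections F U\<^esub>"
      by (auto simp: germ_def)
    then show "\<exists>W. openin (base F) W \<and> x \<in> W \<and> W \<subseteq> U \<and> restr F U W s = \<one>\<^bsub>sections F W\<^esub>"
      using U by (auto simp: restr_one)
  qed
next
  assume R: ?R
  have "\<tau> = (\<lambda>x\<in>U. germ F x U \<one>\<^bsub>sections F U\<^esub>)"
    if U: "openin (base F) U" and \<tau>: "\<tau> \<in> carrier (sections (sheafify F) U)" for U \<tau>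
  proof (rule extensionalityI)
    show "\<tau> \<in> extensional U" using \<tau> by (simp add: sheafify_def)
    fix x assume x: "x \<in> U"
    with \<tau> obtain V s where V: "openin (base F) V" "x \<in> V" "V \<subseteq> U"
      and s: "s \<in> carrier (sections F V)" and germ: "\<tau> x = germ F x V s"
      by (auto simp: sheafify_def)
    from R[rule_format, OF V(1) s V(2)] obtain W where W: "openin (base F) W" "x \<in> W" "W \<subseteq> V"
      "restr F V W s = \<one>\<^bsub>sections F W\<^esub>" by auto
    have "germ F x V s = germ F x U \<one>\<^bsub>sections F U\<^esub>"
      by (rule germ_eq[of _ _ W]) (use U V W s one_closed restr_one in auto)
    with germ x show "\<tau> x = (\<lambda>x\<in>U. germ F x U \<one>\<^bsub>sections F U\<^esub>) x" by simp
  qed auto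
  moreover have "(\<lambda>x\<in>U. germ F x U \<one>\<^bsub>sections F U\<^esub>) \<in> carrier (sections (sheafify F) U)"
    if "openin (base F) U" for U
    using that one_closed
    by (auto simp: sheafify_def intro!: exI[of _ U] bexI[of _ "\<one>\<^bsub>sections F U\<^esub>"])
  ultimately show "zero_sheaf (sheafify F)"
    by (auto simp: zero_sheaf_def) (auto simp: sheafify_def)
qed

end

section \<open>The homology presheaf of the Koszul complex\<close>

lemma on_cone_add:
  fixes h h' :: "_ \<Rightarrow> _ \<Rightarrow> 'e::monoid_add"
  shows "on_cone s1 s2 U (h + h') = on_cone s1 s2 U h + on_cone s1 s2 U h'"
  by (auto simp: on_cone_def fun_eq_iff)

lemma twist_sections_restrict:
  assumes "\<sigma> \<in> twist_sections s1 s2 a b U" "openin (zariski s1 s2) V" "V \<subseteq> U"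
  shows "on_cone s1 s2 V \<sigma> \<in> twist_sections s1 s2 a b V"
  unfolding twist_sections_def
proof (intro CollectI conjI ballI)
  show "on_cone s1 s2 V (on_cone s1 s2 V \<sigma>) = on_cone s1 s2 V \<sigma>" by (simp add: on_cone_on_cone)
  fix x assume "x \<in> V"
  with assms obtain W c d F G where FG: "F \<in> bihom (a + c) (b + d)" "G \<in> bihom c d"
    and W: "openin (zariski s1 s2) W" "x \<in> W"
      "\<forall>(f, g)\<in>cone s1 s2 W. G f g \<noteq> 0 \<and> \<sigma> f g = F f g / G f g"
    unfolding twist_sections_def by blast
  have "\<forall>(f, g)\<in>cone s1 s2 (W \<inter> V). G f g \<noteq> 0 \<and> on_cone s1 s2 V \<sigma> f g = F f g / G f g"
    using W(3) cone_mono[of "W \<inter> V" W s1 s2] cone_mono[of "W \<inter> V" V s1 s2]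
    by (auto simp: on_cone_def)
  moreover have "openin (zariski s1 s2) (W \<inter> V)" using W assms by blast
  ultimately show "\<exists>W c d. \<exists>F\<in>bihom (a + c) (b + d). \<exists>G\<in>bihom c d.
      openin (zariski s1 s2) W \<and> x \<in> W \<and> W \<subseteq> V \<and>
      (\<forall>(f, g)\<in>cone s1 s2 W. G f g \<noteq> 0 \<and> on_cone s1 s2 V \<sigma> f g = F f g / G f g)"
    using FG W(2) \<open>x \<in> V\<close> by blast
qed

lemma twist_sheaf_restrict:
  assumes "vector_space s" "h \<in> carrier (sections (twist_sheaf s1 s2 s E a b) U)"
    "openin (zariski s1 s2) V" "V \<subseteq> U"
  shows "on_cone s1 s2 V h \<in> carrier (sections (twist_sheaf s1 s2 s E a b) V)"
proof -
  interpret vector_space s by fact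
  from assms(2) obtain xs where xs: "set xs \<subseteq> E \<times> twist_sections s1 s2 a b U"
    and h: "h = (\<lambda>f g. \<Sum>(e, \<sigma>)\<leftarrow>xs. s (\<sigma> f g) e)" by (auto simp: twist_sheaf_def)
  let ?ys = "map (\<lambda>(e, \<sigma>). (e, on_cone s1 s2 V \<sigma>)) xs"
  have "on_cone s1 s2 V h f g = (\<Sum>(e, \<sigma>)\<leftarrow>?ys. s (\<sigma> f g) e)" for f g
  proof (cases "(f, g) \<in> cone s1 s2 V")
    case True
    then show ?thesis by (simp add: h on_cone_def case_prod_unfold comp_def)
  next
    case False
    then show ?thesis by (simp add: on_cone_def case_prod_unfold comp_def)
  qed
  then have "on_cone s1 s2 V h = (\<lambda>f g. \<Sum>(e, \<sigma>)\<leftarrow>?ys. s (\<sigma> f g) e)" by blast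
  moreover have "set ?ys \<subseteq> E \<times> twist_sections s1 s2 a b V"
    using xs twist_sections_restrict[OF _ assms(3,4)] by fastforce
  ultimately show ?thesis
    unfolding twist_sheaf_def by (simp only: presheaf.simps partial_object.simps) blast
qed

lemma twist_sheaf_zero: "0 \<in> carrier (sections (twist_sheaf s1 s2 s E a b) U)"
  by (auto simp: twist_sheaf_def fun_eq_iff intro!: exI[of _ "[]"])

lemma twist_sheaf_single:
  "e \<in> E \<Longrightarrow> \<sigma> \<in> twist_sections s1 s2 a b U \<Longrightarrow>
    (\<lambda>f g. s (\<sigma> f g) e) \<in> carrier (sections (twist_sheaf s1 s2 s E a b) U)"
  by (auto simp: twist_sheaf_def intro!: exI[of _ "[(e, \<sigma>)]"])

lemma twist_sheaf_add:
  assumes "h \<in> carrier (sections (twist_sheaf s1 s2 s E a b) U)"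
    "h' \<in> carrier (sections (twist_sheaf s1 s2 s E a b) U)"
  shows "h + h' \<in> carrier (sections (twist_sheaf s1 s2 s E a b) U)"
proof -
  from assms obtain xs ys where
    "set xs \<subseteq> E \<times> twist_sections s1 s2 a b U" "h = (\<lambda>f g. \<Sum>(e, \<sigma>)\<leftarrow>xs. s (\<sigma> f g) e)"
    "set ys \<subseteq> E \<times> twist_sections s1 s2 a b U" "h' = (\<lambda>f g. \<Sum>(e, \<sigma>)\<leftarrow>ys. s (\<sigma> f g) e)"
    by (auto simp: twist_sheaf_def)
  then show ?thesis by (auto simp: twist_sheaf_def fun_eq_iff intro!: exI[of _ "xs @ ys"])
qed

lemma vector_space_tensor_scale:
  "vector_space (tensor_scale :: 'k::field \<Rightarrow> ('k, 'v, 'w) tensor \<Rightarrow> _)"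
  by unfold_locales (auto simp: tensor_scale_def fun_eq_iff algebra_simps)

section \<open>Cycles, boundaries and homology classes of the Koszul complex\<close>

locale koszul = tensor_pair s1 s2 B1 B2
  for s1 :: "'k::field \<Rightarrow> 'v::ab_group_add \<Rightarrow> 'v" and s2 :: "'k \<Rightarrow> 'w::ab_group_add \<Rightarrow> 'w"
    and B1 B2 +
  fixes K :: "('k, 'v, 'w) tensor set"
  assumes K_tensors: "K \<subseteq> tensor_space s1 s2"
    and K_subspace: "module.subspace tensor_scale K"
begin

interpretation T: vector_space "tensor_scale :: 'k \<Rightarrow> ('k, 'v, 'w) tensor \<Rightarrow> _"
  by (rule vector_space_tensor_scale)

abbreviation "tensor_sections U \<equiv> carrier (sections (twist_sheaf s1 s2 tensor_scale K 0 0) U)"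

definition "vector_sections =
  direct_sum_sheaf (twist_sheaf s1 s2 s1 UNIV 0 1) (twist_sheaf s1 s2 s2 UNIV 1 0)"

definition "homology = homology_presheaf (twist_sheaf s1 s2 tensor_scale K 0 0)
  (koszul_alpha s1 s2) vector_sections (koszul_beta s1 s2) (twist_sheaf s1 s2 (*) UNIV 1 1)"

abbreviation "restrict_pair V \<equiv> map_prod (on_cone s1 s2 V) (on_cone s1 s2 V)"

definition "boundaries U = koszul_alpha s1 s2 U ` tensor_sections U"

definition "cycles U = {b \<in> carrier (sections vector_sections U). koszul_beta s1 s2 U b = 0}"

definition "homology_class U b = (\<lambda>a. a + b) ` boundaries U"

text \<open>Evaluation at a pair of functionals turns a section with coefficients in
  \<open>K\<close> into one tensor of \<open>K\<close>, on which a form in the annihilator vanishes.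
  In the converse implication, this is what carries an identity of sections to the fibre at a
  point.\<close>

lemma tensor_section_value: "A \<in> tensor_sections U \<Longrightarrow> A f g \<in> K"
proof -
  assume "A \<in> tensor_sections U"
  then obtain xs where xs: "set xs \<subseteq> K \<times> UNIV" and A: "A = (\<lambda>f g. \<Sum>(t, \<sigma>)\<leftarrow>xs. tensor_scale (\<sigma> f g) t)"
    by (fastforce simp: twist_sheaf_def)
  from xs show ?thesis unfolding A
  proof (induction xs)
    case Nil
    show ?case using T.subspace_0[OF K_subspace] by (simp add: zero_fun_def)
  next
    case (Cons y xs)
    then show ?case
      by (cases y) (auto intro!: T.subspace_add[OF K_subspace] T.subspace_scale[OF K_subspace]
          simp del: plus_fun_apply)
  qed
qed

lemma koszul_alpha_zero: "koszul_alpha s1 s2 U 0 = 0"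
  and koszul_alpha_add: "A \<in> tensor_sections U \<Longrightarrow> A' \<in> tensor_sections U \<Longrightarrow>
    koszul_alpha s1 s2 U (A + A') = koszul_alpha s1 s2 U A + koszul_alpha s1 s2 U A'"
proof -
  have zero: "tensor_lift s1 s2 b 0 = 0" if "bilinear_map s b"
    for s and b :: "'v \<Rightarrow> 'w \<Rightarrow> 'u::ab_group_add"
    using tensor_lift_combination[OF that, of "[]"] by simp
  have add: "tensor_lift s1 s2 b (t + t') = tensor_lift s1 s2 b t + tensor_lift s1 s2 b t'"
    if b: "bilinear_map s b" and "t \<in> K" "t' \<in> K"
    for s and b :: "'v \<Rightarrow> 'w \<Rightarrow> 'u::ab_group_add" and t t'
  proof -
    interpret U: vector_space s using b by (auto simp: bilinear_map_def Vector_Spaces.linear_iff)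
    show ?thesis
      using tensor_lift_combination[OF b, of "[(t, 1), (t', 1)]"] that K_tensors
      by (auto simp del: plus_fun_apply)
  qed
  show "koszul_alpha s1 s2 U 0 = 0"
    using zero[OF bilinear_left] zero[OF bilinear_right]
    by (auto simp: koszul_alpha_def on_cone_def fun_eq_iff zero_prod_def cone_def)
  assume "A \<in> tensor_sections U" "A' \<in> tensor_sections U"
  from tensor_section_value[OF this(1)] tensor_section_value[OF this(2)]
  show "koszul_alpha s1 s2 U (A + A') = koszul_alpha s1 s2 U A + koszul_alpha s1 s2 U A'"
    using add[OF bilinear_left] add[OF bilinear_right]
    by (auto simp: koszul_alpha_def on_cone_def fun_eq_iff cone_def)
qed

lemma koszul_alpha_restrict:
  "V \<subseteq> U \<Longrightarrow> koszul_alpha s1 s2 V (on_cone s1 s2 V A) = restrict_pair V (koszul_alpha s1 s2 U A)"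
  using cone_mono[of V U s1 s2] by (auto simp: koszul_alpha_def on_cone_def fun_eq_iff)

lemma boundaries_zero: "0 \<in> boundaries U"
  unfolding boundaries_def using koszul_alpha_zero twist_sheaf_zero by (metis imageI)

lemma boundaries_add: "a \<in> boundaries U \<Longrightarrow> a' \<in> boundaries U \<Longrightarrow> a + a' \<in> boundaries U"
  unfolding boundaries_def using koszul_alpha_add twist_sheaf_add
  by (smt (verit) image_iff)

lemma boundaries_uminus: "a \<in> boundaries U \<Longrightarrow> - a \<in> boundaries U"
proof -
  assume "a \<in> boundaries U"
  then obtain A where A: "A \<in> tensor_sections U" "a = koszul_alpha s1 s2 U A"
    by (auto simp: boundaries_def)
  then obtain xs where xs: "set xs \<subseteq> K \<times> twist_sections s1 s2 0 0 U"
    and A_eq: "A = (\<lambda>f g. \<Sum>(t, \<sigma>)\<leftarrow>xs. tensor_scale (\<sigma> f g) t)"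
    by (auto simp: twist_sheaf_def)
  \<comment> \<open>The sign is placed on the tensors, where the subspace \<open>K\<close> absorbs
    it, so the coefficient functions stay unchanged.\<close>
  let ?ys = "map (\<lambda>(t, \<sigma>). (tensor_scale (- 1) t, \<sigma>)) xs"
  define A' where "A' = (\<lambda>f g. \<Sum>(t, \<sigma>)\<leftarrow>?ys. tensor_scale (\<sigma> f g) t)"
  have "set ?ys \<subseteq> K \<times> twist_sections s1 s2 0 0 U"
    using xs T.subspace_scale[OF K_subspace, of _ "- 1"] by auto
  then have A': "A' \<in> tensor_sections U"
    unfolding twist_sheaf_def A'_def by (simp only: presheaf.simps partial_object.simps) blast
  have "A f g + A' f g = 0" for f g
    unfolding A_eq A'_def by (induction xs) (auto simp: tensor_scale_def fun_eq_iff)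
  then have "A + A' = 0" by (simp add: fun_eq_iff)
  then have "a + koszul_alpha s1 s2 U A' = 0"
    using koszul_alpha_add[OF A(1) A'] koszul_alpha_zero A(2) by simp
  then show ?thesis using A' by (metis boundaries_def imageI minus_unique)
qed

lemma boundaries_restrict:
  assumes "a \<in> boundaries U" "openin (zariski s1 s2) V" "V \<subseteq> U"
  shows "restrict_pair V a \<in> boundaries V"
proof -
  from assms obtain A where A: "A \<in> tensor_sections U" "a = koszul_alpha s1 s2 U A"
    by (auto simp: boundaries_def)
  then show ?thesis
    using twist_sheaf_restrict[OF vector_space_tensor_scale A(1) assms(2,3)]
      koszul_alpha_restrict[OF assms(3), of A] unfolding boundaries_def by (metis imageI)
qed

lemma restrict_pair_add:
  fixes a b :: "(('v \<Rightarrow> 'k) \<Rightarrow> ('w \<Rightarrow> 'k) \<Rightarrow> 'v) \<times> (('v \<Rightarrow> 'k) \<Rightarrow> ('w \<Rightarrow> 'k) \<Rightarrow> 'w)"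
  shows "restrict_pair V (a + b) = restrict_pair V a + restrict_pair V b"
  by (cases a; cases b) (simp add: on_cone_add)

lemma homology_class_eq_boundaries_iff: "homology_class U b = boundaries U \<longleftrightarrow> b \<in> boundaries U"
proof
  assume "homology_class U b = boundaries U"
  moreover have "0 + b \<in> homology_class U b"
    unfolding homology_class_def using boundaries_zero by blast
  ultimately show "b \<in> boundaries U" by simp
next
  assume b: "b \<in> boundaries U"
  then have "a = (a + - b) + b \<and> a + - b \<in> boundaries U" if "a \<in> boundaries U" for a
    using boundaries_add[OF that boundaries_uminus[OF b]] by simp
  with b show "homology_class U b = boundaries U"
    unfolding homology_class_def using boundaries_add by blast
qed

lemma mult_vector_sections: "a \<otimes>\<^bsub>sections vector_sections U\<^esub> b = a + b"
  by (cases a; cases b) (simp add: vector_sections_def direct_sum_sheaf_def twist_sheaf_def)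

lemma carrier_vector_sections: "carrier (sections vector_sections U) =
    carrier (sections (twist_sheaf s1 s2 s1 UNIV 0 1) U) \<times>
    carrier (sections (twist_sheaf s1 s2 s2 UNIV 1 0) U)"
  by (simp add: vector_sections_def direct_sum_sheaf_def)

lemma base_homology: "base homology = zariski s1 s2"
  by (simp add: homology_def homology_presheaf_def vector_sections_def direct_sum_sheaf_def
      twist_sheaf_def)

lemma one_homology: "\<one>\<^bsub>sections homology U\<^esub> = boundaries U"
  by (simp add: homology_def homology_presheaf_def FactGroup_def boundaries_def)

lemma carrier_homology: "carrier (sections homology U) = homology_class U ` cycles U"
proof -
  have "kernel (sections vector_sections U) (sections (twist_sheaf s1 s2 (*) UNIV 1 1) U)
      (koszul_beta s1 s2 U) = cycles U"
    by (simp add: kernel_def cycles_def twist_sheaf_def)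
  then show ?thesis
    by (auto simp: homology_def homology_presheaf_def FactGroup_def RCOSETS_def r_coset_def
        boundaries_def[symmetric] mult_vector_sections homology_class_def)
qed

text \<open>Boundaries over \<open>V\<close> need not extend to \<open>U\<close>, so restricting the
  elements of a coset may give only part of a coset. The product with all boundaries over
  \<open>V\<close> completes it and adds nothing else, because restricted boundaries are
  boundaries.\<close>

lemma restr_homology:
  assumes "openin (zariski s1 s2) V" "V \<subseteq> U"
  shows "restr homology U V (homology_class U b) = homology_class V (restrict_pair V b)"
proof -
  have "restr vector_sections U V = restrict_pair V"
    by (simp add: vector_sections_def direct_sum_sheaf_def twist_sheaf_def)
  then have "restr homology U V (homology_class U b) =
      boundaries V <#>\<^bsub>sections vector_sections V\<^esub> (restrict_pair V ` homology_class U b)"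
    by (simp add: homology_def homology_presheaf_def boundaries_def)
  also have "\<dots> = {a' + restrict_pair V (a + b) | a' a. a' \<in> boundaries V \<and> a \<in> boundaries U}"
    unfolding set_mult_def mult_vector_sections homology_class_def by (auto; blast)
  also have "\<dots> = homology_class V (restrict_pair V b)"
  proof (intro equalityI subsetI)
    fix c assume "c \<in> {a' + restrict_pair V (a + b) | a' a. a' \<in> boundaries V \<and> a \<in> boundaries U}"
    then obtain a' a where a: "a' \<in> boundaries V" "a \<in> boundaries U"
      and c: "c = a' + restrict_pair V (a + b)"
      by auto
    have "c = (a' + restrict_pair V a) + restrict_pair V b"
      by (simp only: c restrict_pair_add add.assoc)
    then show "c \<in> homology_class V (restrict_pair V b)"
      unfolding homology_class_def
      using boundaries_add[OF a(1) boundaries_restrict[OF a(2) assms]] by blast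
  next
    fix c assume "c \<in> homology_class V (restrict_pair V b)"
    then obtain a' where "a' \<in> boundaries V" "c = a' + restrict_pair V (0 + b)"
      by (auto simp: homology_class_def)
    then show "c \<in> {a' + restrict_pair V (a + b) | a' a. a' \<in> boundaries V \<and> a \<in> boundaries U}"
      using boundaries_zero by blast
  qed
  finally show ?thesis .
qed

lemma cycles_zero: "0 \<in> cycles U"
proof -
  have "f 0 + g 0 = 0" if "(f, g) \<in> cone s1 s2 U" for f g
    using that by (auto simp: cone_def dual_zero)
  then show ?thesis
    by (auto simp: cycles_def zero_prod_def koszul_beta_def on_cone_def carrier_vector_sections
        twist_sheaf_zero fun_eq_iff)
qed

sublocale zero_presheaf homology
proof
  have one: "homology_class U 0 = \<one>\<^bsub>sections homology U\<^esub>" for U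
    using homology_class_eq_boundaries_iff boundaries_zero by (simp add: one_homology)
  show "\<one>\<^bsub>sections homology U\<^esub> \<in> carrier (sections homology U)" for U
    unfolding one[symmetric] carrier_homology using cycles_zero by blast
  show "restr homology U V \<one>\<^bsub>sections homology U\<^esub> = \<one>\<^bsub>sections homology V\<^esub>"
    if "openin (base homology) U" "openin (base homology) V" "V \<subseteq> U" for U V
  proof -
    have "restrict_pair V (0 :: (_ \<Rightarrow> _ \<Rightarrow> 'v) \<times> (_ \<Rightarrow> _ \<Rightarrow> 'w)) = 0"
      by (simp add: zero_prod_def on_cone_def fun_eq_iff)
    with that restr_homology[of V U 0] show ?thesis by (simp add: base_homology one)
  qed
  show "restr homology V W (restr homology U V s) = restr homology U W s"
    if "openin (base homology) U" "openin (base homology) V" "openin (base homology) W"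
      "W \<subseteq> V" "V \<subseteq> U" "s \<in> carrier (sections homology U)" for U V W s
    using that
    by (auto simp: base_homology carrier_homology restr_homology on_cone_on_cone)
qed

text \<open>The germ criterion for the homology presheaf becomes local exactness at the middle term:
  a class restricts to the neutral coset exactly when its cycle restricts to a boundary.\<close>

lemma zero_koszul_sheaf_iff:
  "zero_sheaf (koszul_sheaf s1 s2 K) \<longleftrightarrow>
    (\<forall>U b x. openin (zariski s1 s2) U \<longrightarrow> b \<in> cycles U \<longrightarrow> x \<in> U \<longrightarrow>
      (\<exists>W. openin (zariski s1 s2) W \<and> x \<in> W \<and> W \<subseteq> U \<and> restrict_pair W b \<in> boundaries W))"
proof -
  have eq: "(\<exists>W. openin (zariski s1 s2) W \<and> x \<in> W \<and> W \<subseteq> U \<and>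
        restr homology U W (homology_class U b) = \<one>\<^bsub>sections homology W\<^esub>) \<longleftrightarrow>
      (\<exists>W. openin (zariski s1 s2) W \<and> x \<in> W \<and> W \<subseteq> U \<and> restrict_pair W b \<in> boundaries W)"
    for U b x
    by (intro ex_cong1 conj_cong refl)
      (simp add: restr_homology one_homology homology_class_eq_boundaries_iff)
  have sheafify: "koszul_sheaf s1 s2 K = sheafify homology"
    by (simp add: koszul_sheaf_def homology_sheaf_def homology_def vector_sections_def)
  have "zero_sheaf (koszul_sheaf s1 s2 K) \<longleftrightarrow>
    (\<forall>U. openin (zariski s1 s2) U \<longrightarrow> (\<forall>s\<in>homology_class U ` cycles U. \<forall>x\<in>U.
      \<exists>W. openin (zariski s1 s2) W \<and> x \<in> W \<and> W \<subseteq> U \<and>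
        restr homology U W s = \<one>\<^bsub>sections homology W\<^esub>))"
    unfolding sheafify zero_sheaf_sheafify_iff base_homology carrier_homology Ball_def by meson
  then show ?thesis unfolding ball_simps eq by meson
qed

text \<open>With \<open>\<phi> = h\<^sub>1 \<otimes> g\<^sub>0 + f\<^sub>0 \<otimes>
  h\<^sub>2\<close>, the form \<phi> factors through the fibre of \<alpha> at
  \<open>([f\<^sub>0], [g\<^sub>0])\<close>. If the cycle obtained from
  \<open>v\<^sub>0 \<otimes> w\<^sub>0\<close> were a boundary near that point, some tensor in
  \<open>K\<close> would have the same image in the fibre, and \<phi> would take the value 0 on it
  but a non-zero value on \<open>v\<^sub>0 \<otimes> w\<^sub>0\<close>.\<close>

lemma low_rank_imp_nonzero:
  assumes \<phi>: "\<phi> \<in> annihilator s1 s2 K" "\<phi> \<noteq> 0" "tensor_rank s1 s2 \<phi> \<le> 2"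
  shows "\<not> zero_sheaf (koszul_sheaf s1 s2 K)"
proof
  assume zero: "zero_sheaf (koszul_sheaf s1 s2 K)"
  have "\<phi> \<in> dual_tensor_space s1 s2" using \<phi> by (simp add: annihilator_def)
  then obtain f\<^sub>0 g\<^sub>0 h\<^sub>1 h\<^sub>2 where fg: "f\<^sub>0 \<in> dual s1 - {0}" "g\<^sub>0 \<in> dual s2 - {0}"
    and h: "h\<^sub>1 \<in> dual s1" "h\<^sub>2 \<in> dual s2" and \<phi>_eq: "\<phi> = dual_tensor_sum [(h\<^sub>1, g\<^sub>0), (f\<^sub>0, h\<^sub>2)]"
    using tensor_rank_le2_cases[OF _ \<phi>(2,3)] by blast
  from \<phi>(2) obtain v\<^sub>0 w\<^sub>0 where nz: "\<phi> v\<^sub>0 w\<^sub>0 \<noteq> 0" by (auto simp: fun_eq_iff)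
  let ?U = "topspace (zariski s1 s2)" and ?x = "(proj_point f\<^sub>0, proj_point g\<^sub>0)"
  have x: "?x \<in> ?U" using fg by (auto simp: topspace_zariski basic_open_def)
  \<comment> \<open>The value of the formula for \<alpha> at the constant section
    \<open>v\<^sub>0 \<otimes> w\<^sub>0\<close>, taken over the whole space.\<close>
  define b where "b = (on_cone s1 s2 ?U (\<lambda>f g. s1 (g w\<^sub>0) v\<^sub>0), on_cone s1 s2 ?U (\<lambda>f g. - s2 (f v\<^sub>0) w\<^sub>0))"
  have tw: "on_cone s1 s2 ?U (\<lambda>f g. f v\<^sub>0) \<in> twist_sections s1 s2 1 0 ?U"
    "on_cone s1 s2 ?U (\<lambda>f g. g w\<^sub>0) \<in> twist_sections s1 s2 0 1 ?U"
    by (rule twist_sectionsI[where F = "\<lambda>f g. f v\<^sub>0" and G = "\<lambda>_ _. 1" and c = 0 and d = 0];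
        use bihom_eval_left[of v\<^sub>0] bihom_const[of 1] in simp)
      (rule twist_sectionsI[where F = "\<lambda>f g. g w\<^sub>0" and G = "\<lambda>_ _. 1" and c = 0 and d = 0];
        use bihom_eval_right[of w\<^sub>0] bihom_const[of 1] in simp)
  have "b \<in> cycles ?U"
  proof -
    \<comment> \<open>The sign moves to the vector \<open>- w\<^sub>0\<close>, so that each
      component is one section of a twisting sheaf times a fixed vector.\<close>
    have "fst b = (\<lambda>f g. s1 (on_cone s1 s2 ?U (\<lambda>f g. g w\<^sub>0) f g) v\<^sub>0)"
      "snd b = (\<lambda>f g. s2 (on_cone s1 s2 ?U (\<lambda>f g. f v\<^sub>0) f g) (- w\<^sub>0))"
      by (auto simp: b_def on_cone_def fun_eq_iff)
    then have "fst b \<in> carrier (sections (twist_sheaf s1 s2 s1 UNIV 0 1) ?U)"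
      "snd b \<in> carrier (sections (twist_sheaf s1 s2 s2 UNIV 1 0) ?U)"
      using twist_sheaf_single[OF UNIV_I tw(2)] twist_sheaf_single[OF UNIV_I tw(1)] by (simp_all only:)
    moreover have "koszul_beta s1 s2 ?U b = 0"
      by (auto simp: koszul_beta_def b_def on_cone_def fun_eq_iff cone_def dual_scale dual_minus)
    ultimately show ?thesis by (cases b) (simp add: cycles_def carrier_vector_sections)
  qed
  from zero[unfolded zero_koszul_sheaf_iff, rule_format, OF openin_topspace this x]
  obtain W where W: "?x \<in> W" "W \<subseteq> ?U" "restrict_pair W b \<in> boundaries W"
    by auto
  from W(3) obtain A where A: "A \<in> tensor_sections W" "restrict_pair W b = koszul_alpha s1 s2 W A"
    by (auto simp: boundaries_def)
  have "(f\<^sub>0, g\<^sub>0) \<in> cone s1 s2 W" "(f\<^sub>0, g\<^sub>0) \<in> cone s1 s2 ?U"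
    using fg W by (auto simp: cone_def)
  then have "fst (restrict_pair W b) f\<^sub>0 g\<^sub>0 = s1 (g\<^sub>0 w\<^sub>0) v\<^sub>0" "snd (restrict_pair W b) f\<^sub>0 g\<^sub>0 = - s2 (f\<^sub>0 v\<^sub>0) w\<^sub>0"
    "fst (koszul_alpha s1 s2 W A) f\<^sub>0 g\<^sub>0 = tensor_lift s1 s2 (\<lambda>v w. s1 (g\<^sub>0 w) v) (A f\<^sub>0 g\<^sub>0)"
    "snd (koszul_alpha s1 s2 W A) f\<^sub>0 g\<^sub>0 = - tensor_lift s1 s2 (\<lambda>v w. s2 (f\<^sub>0 v) w) (A f\<^sub>0 g\<^sub>0)"
    by (simp_all add: b_def on_cone_def koszul_alpha_def)
  with A(2) have lift: "tensor_lift s1 s2 (\<lambda>v w. s1 (g\<^sub>0 w) v) (A f\<^sub>0 g\<^sub>0) = s1 (g\<^sub>0 w\<^sub>0) v\<^sub>0"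
    "tensor_lift s1 s2 (\<lambda>v w. s2 (f\<^sub>0 v) w) (A f\<^sub>0 g\<^sub>0) = s2 (f\<^sub>0 v\<^sub>0) w\<^sub>0"
    by simp_all
  have t: "A f\<^sub>0 g\<^sub>0 \<in> K" using tensor_section_value[OF A(1)] .
  with K_tensors obtain ys where ys: "A f\<^sub>0 g\<^sub>0 = tensor_sum s1 s2 ys"
    unfolding tensor_space_def by blast
  have "set [(h\<^sub>1, g\<^sub>0), (f\<^sub>0, h\<^sub>2)] \<subseteq> dual s1 \<times> dual s2" using fg h by auto
  from tensor_lift_tensor_sum[OF bilinear_dual_tensor_sum[OF this], of ys]
  have "tensor_lift s1 s2 \<phi> (A f\<^sub>0 g\<^sub>0) = (\<Sum>(v, w)\<leftarrow>ys. \<phi> v w)"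
    by (simp add: \<phi>_eq ys)
  \<comment> \<open>The form \<phi> sees a tensor only through its contractions with
    \<open>g\<^sub>0\<close> and with \<open>f\<^sub>0\<close>, which are, up to sign, the two
    components of \<alpha> at the point. By \<open>lift\<close> these agree with the contractions of
    \<open>v\<^sub>0 \<otimes> w\<^sub>0\<close>.\<close>
  also have "\<dots> = h\<^sub>1 (\<Sum>(v, w)\<leftarrow>ys. s1 (g\<^sub>0 w) v) + h\<^sub>2 (\<Sum>(v, w)\<leftarrow>ys. s2 (f\<^sub>0 v) w)"
    by (induction ys) (auto simp: \<phi>_eq dual_tensor_sum_def dual_add[OF h(1)] dual_add[OF h(2)]
        dual_scale[OF h(1)] dual_scale[OF h(2)] dual_zero[OF h(1)] dual_zero[OF h(2)])
  also have "\<dots> = h\<^sub>1 (s1 (g\<^sub>0 w\<^sub>0) v\<^sub>0) + h\<^sub>2 (s2 (f\<^sub>0 v\<^sub>0) w\<^sub>0)"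
    using lift fg unfolding ys
    by (simp only: tensor_lift_tensor_sum[OF bilinear_left] tensor_lift_tensor_sum[OF bilinear_right] Diff_iff)
  also have "\<dots> = \<phi> v\<^sub>0 w\<^sub>0"
    by (simp add: \<phi>_eq dual_tensor_sum_def dual_scale[OF h(1)] dual_scale[OF h(2)])
  finally show False using nz \<phi>(1) t by (simp add: annihilator_def)
qed

lemma no_low_rank_imp_zero:
  assumes "\<And>\<phi>. \<phi> \<in> annihilator s1 s2 K \<Longrightarrow> tensor_rank s1 s2 \<phi> \<le> 2 \<Longrightarrow> \<phi> = 0"
  shows "zero_sheaf (koszul_sheaf s1 s2 K)"
  unfolding zero_koszul_sheaf_iff
proof (intro allI impI)
  fix U b x assume U: "openin (zariski s1 s2) U" "x \<in> U" and b: "b \<in> cycles U"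
  obtain P Q where b_eq: "b = (P, Q)" by (cases b)
  from b have P: "P \<in> carrier (sections (twist_sheaf s1 s2 s1 UNIV 0 1) U)"
    and Q: "Q \<in> carrier (sections (twist_sheaf s1 s2 s2 UNIV 1 0) U)"
    and beta: "koszul_beta s1 s2 U (P, Q) = 0"
    by (auto simp: cycles_def b_eq carrier_vector_sections)
  from beta have ker: "f (P f g) + g (Q f g) = 0" if "(f, g) \<in> cone s1 s2 U" for f g
    using that by (auto simp: koszul_beta_def on_cone_def fun_eq_iff split: if_splits)
  from U openin_subset have "x \<in> topspace (zariski s1 s2)" by blast
  then obtain f\<^sub>0 g\<^sub>0 where fg: "f\<^sub>0 \<in> dual s1 - {0}" "g\<^sub>0 \<in> dual s2 - {0}"
    and x: "x = (proj_point f\<^sub>0, proj_point g\<^sub>0)"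
    by (auto simp: topspace_zariski basic_open_def)
  \<comment> \<open>Vectors on which the chosen representatives do not vanish provide the linear
    forms that trivialise the twisting sheaves at this point.\<close>
  from fg obtain e\<^sub>1 e\<^sub>2 where e: "f\<^sub>0 e\<^sub>1 \<noteq> 0" "g\<^sub>0 e\<^sub>2 \<noteq> 0" by (auto simp: fun_eq_iff)
  interpret koszul_point s1 s2 B1 B2 f\<^sub>0 g\<^sub>0 K e\<^sub>1 e\<^sub>2
    by unfold_locales (use fg e K_tensors assms in auto)
  obtain W A where
    "openin (zariski s1 s2) W" "x \<in> W" "W \<subseteq> U" "A \<in> tensor_sections W"
    "koszul_alpha s1 s2 W A = (on_cone s1 s2 W P, on_cone s1 s2 W Q)"
    unfolding x using local_lift[OF U(1) U(2)[unfolded x] P Q] ker by metis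
  then show "\<exists>W. openin (zariski s1 s2) W \<and> x \<in> W \<and> W \<subseteq> U \<and> restrict_pair W b \<in> boundaries W"
    unfolding boundaries_def b_eq by (metis imageI map_prod_simp)
qed

end

theorem proposition3p5:
  fixes s1 :: "'k::alg_closed_field \<Rightarrow> 'v::ab_group_add \<Rightarrow> 'v"
    and s2 :: "'k \<Rightarrow> 'w::ab_group_add \<Rightarrow> 'w"
    and B1 :: "'v set" and B2 :: "'w set"
    and K :: "('k, 'v, 'w) tensor set"
  assumes "finite_dimensional_vector_space s1 B1"
    and "finite_dimensional_vector_space s2 B2"
    and "vector_space.dim s1 (UNIV :: 'v set) \<ge> 2"
    and "vector_space.dim s2 (UNIV :: 'w set) \<ge> 2"
    and "K \<subseteq> tensor_space s1 s2"
    and "module.subspace tensor_scale K"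
  shows "zero_sheaf (koszul_sheaf s1 s2 K) \<longleftrightarrow>
    \<not> (\<exists>\<phi>\<in>annihilator s1 s2 K. \<phi> \<noteq> 0 \<and> tensor_rank s1 s2 \<phi> \<le> 2)"
proof -
  interpret vs1: finite_dimensional_vector_space s1 B1 by (fact assms(1))
  interpret vs2: finite_dimensional_vector_space s2 B2 by (fact assms(2))
  interpret koszul s1 s2 B1 B2 K
    by unfold_locales (use assms in auto)
  show ?thesis using low_rank_imp_nonzero no_low_rank_imp_zero by blast
qed

end
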